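(* Let $G$ be a finite abelian group of order $n$, let $m$ be a positive integer with $\gcd(n,m)=1$, and let $c\in\operatorname{Aut}(G)$ have order $d$. Assume that $c$ is semiregular on $G\setminus\{0\}$. Then the triple $$\bigl(m\mathcal P_G\cap\mathbb Z^n,\ \langle\widetilde c\rangle,\ \mathsf{Cat}_{n,m}(q)\bigr)$$ exhibits the cyclic sieving phenomenon.
   Context: Zero-sum polytope: for a finite abelian group $G$ of order $n$ (additive), let $\Delta_G=\{x\in\mathbb R_{\ge0}^G:\sum_g x_g=1\}$ and $\Lambda_G=\{(a_g)\in\mathbb Z^G:\sum_g a_g g=0\text{ in }G\}$, a full-rank sublattice of $\mathbb Z^G$. Fix a linear isomorphism $T:\mathbb R^G\to\mathbb R^n$ with $T(\Lambda_G)=\mathbb Z^n$ and put $\mathcal P_G=T(\Delta_G)$. Action: $a\in\operatorname{Aut}(G)$ acts linearly on $\mathbb R^G$ by $(a\cdot x)_g=x_{a^{-1}(g)}$, preserving $\Delta_G$ and $\Lambda_G$; set $\widetilde a=TaT^{-1}$, a linear automorphism of $\mathbb R^n$ preserving $\mathbb Z^n$ and $\mathcal P_G$, hence acting on $m\mathcal P_G\cap\mathbb Z^n$. The cyclic group $\langle\widetilde c\rangle$ has order $d$ and acts in this way, with generator $\widetilde c$. Semiregular: $c\in\operatorname{Aut}(G)$ of order $d$ is semiregular on $G\setminus\{0\}$ if the set of fixed points of $c^j$ in $G$ is $\{0\}$ for every $1\le j<d$ (equivalently, every orbit of $\langle c\rangle$ on $G\setminus\{0\}$ has size $d$). Cyclic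 sieving: let $X$ be a finite set with an action of a cyclic group $C_N=\langle c\rangle$ of order $N$, let $f(q)\in\mathbb Z_{\ge0}[q]$ satisfy $f(1)=|X|$, and let $\zeta_N$ be a primitive $N$th root of unity. The triple $(X,C_N,f(q))$ exhibits the cyclic sieving phenomenon if $|\{x\in X:c^j\cdot x=x\}|=f(\zeta_N^j)$ for every integer $j$. Rational $q$-Catalan polynomial: with $[k]_q=1+q+\cdots+q^{k-1}$, $[k]!_q=[k]_q\cdots[1]_q$, and $\binom{k}{l}_q=\frac{[k]!_q}{[l]!_q[k-l]!_q}$, for coprime positive integers $n,m$ define $\mathsf{Cat}_{n,m}(q)=\frac{1}{[n+m]_q}\binom{n+m}{m}_q$, which is known to be a polynomial with nonnegative integer coefficients. *)

theory Defs
  imports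
    "HOL-Analysis.Finite_Cartesian_Product"
    "HOL-Computational_Algebra.Polynomial"
    "HOL-Algebra.Bij"
    "HOL-Algebra.Elementary_Groups"
    "HOL-Algebra.Group_Action"
    "HOL-Algebra.Multiplicative_Group"
begin

section \<open>The zero-sum polytope\<close>

text \<open>
  A finite abelian group is a \<open>comm_group\<close> with finite carrier, written multiplicatively as
  usual in HOL-Algebra.  The space \<open>\<real>\<^sup>G\<close> consists of the functions that vanish off the carrier,
  so that each coordinate vector has exactly one representative.
\<close>

definition coord_space :: "('a, 'b) monoid_scheme \<Rightarrow> ('a \<Rightarrow> real) set" where
  "coord_space G = {x. \<forall>g. g \<notin> carrier G \<longrightarrow> x g = 0}"

definition group_simplex :: "('a, 'b) monoid_scheme \<Rightarrow> ('a \<Rightarrow> real) set" where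
  "group_simplex G =
     {x \<in> coord_space G. (\<forall>g\<in>carrier G. 0 \<le> x g) \<and> (\<Sum>g\<in>carrier G. x g) = 1}"

text \<open>The condition \<open>\<Sum> a\<^sub>g g = 0\<close> in multiplicative notation.\<close>

definition zero_sum_lattice :: "('a, 'b) monoid_scheme \<Rightarrow> ('a \<Rightarrow> real) set" where
  "zero_sum_lattice G =
     {x \<in> coord_space G. \<exists>a :: 'a \<Rightarrow> int. (\<forall>g\<in>carrier G. x g = of_int (a g)) \<and>
        (\<Otimes>\<^bsub>G\<^esub>g\<in>carrier G. g [^]\<^bsub>G\<^esub> a g) = \<one>\<^bsub>G\<^esub>}"

definition int_vectors :: "(real ^ 'n) set" where
  "int_vectors = {v. \<forall>i. v $ i \<in> \<int>}"

definition linear_iso_on_coord_space ::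
    "('a, 'b) monoid_scheme \<Rightarrow> (('a \<Rightarrow> real) \<Rightarrow> real ^ 'n) \<Rightarrow> bool" where
  "linear_iso_on_coord_space G T \<longleftrightarrow>
     bij_betw T (coord_space G) UNIV \<and>
     (\<forall>x\<in>coord_space G. \<forall>y\<in>coord_space G. T (\<lambda>g. x g + y g) = T x + T y) \<and>
     (\<forall>r. \<forall>x\<in>coord_space G. T (\<lambda>g. r * x g) = r *\<^sub>R T x)"

definition zero_sum_polytope ::
    "('a, 'b) monoid_scheme \<Rightarrow> (('a \<Rightarrow> real) \<Rightarrow> real ^ 'n) \<Rightarrow> (real ^ 'n) set" where
  "zero_sum_polytope G T = T ` group_simplex G"

definition dilate_lattice_points :: "nat \<Rightarrow> (real ^ 'n) set \<Rightarrow> (real ^ 'n) set" where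
  "dilate_lattice_points m P = (\<lambda>v. real m *\<^sub>R v) ` P \<inter> int_vectors"


section \<open>The action of automorphisms\<close>

definition aut_act :: "('a, 'b) monoid_scheme \<Rightarrow> ('a \<Rightarrow> 'a) \<Rightarrow> ('a \<Rightarrow> real) \<Rightarrow> 'a \<Rightarrow> real" where
  "aut_act G a x = (\<lambda>g. if g \<in> carrier G then x (inv_into (carrier G) a g) else 0)"

definition aut_tilde ::
    "('a, 'b) monoid_scheme \<Rightarrow> (('a \<Rightarrow> real) \<Rightarrow> real ^ 'n) \<Rightarrow> ('a \<Rightarrow> 'a) \<Rightarrow> real ^ 'n \<Rightarrow> real ^ 'n" where
  "aut_tilde G T a = (\<lambda>v. T (aut_act G a (inv_into (coord_space G) T v)))"

definition semiregular :: "('a, 'b) monoid_scheme \<Rightarrow> ('a \<Rightarrow> 'a) \<Rightarrow> bool" where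
  "semiregular G c \<longleftrightarrow>
     (\<forall>j::nat. 1 \<le> j \<and> j < group.ord (AutoGroup G) c \<longrightarrow>
        {g \<in> carrier G. (c [^]\<^bsub>AutoGroup G\<^esub> j) g = g} = {\<one>\<^bsub>G\<^esub>})"


section \<open>Cyclic sieving\<close>

definition primitive_root_of_unity :: "nat \<Rightarrow> complex \<Rightarrow> bool" where
  "primitive_root_of_unity N \<zeta> \<longleftrightarrow> \<zeta> ^ N = 1 \<and> (\<forall>k. 0 < k \<and> k < N \<longrightarrow> \<zeta> ^ k \<noteq> 1)"

text \<open>
  \<open>C\<close> is a finite cyclic group with generator \<open>c\<close>, acting on \<open>X\<close> through \<open>\<phi>\<close>; its order plays the
  role of \<open>N\<close>.  The conditions that \<open>f\<close> has nonnegative coefficients and that \<open>f(1) = |X|\<close> are part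
  of the definition.
\<close>

definition cyclic_sieving ::
    "'x set \<Rightarrow> ('c, 'e) monoid_scheme \<Rightarrow> 'c \<Rightarrow> ('c \<Rightarrow> 'x \<Rightarrow> 'x) \<Rightarrow> int poly \<Rightarrow> bool" where
  "cyclic_sieving X C c \<phi> f \<longleftrightarrow>
     finite X \<and>
     group C \<and> finite (carrier C) \<and> c \<in> carrier C \<and> carrier C = generate C {c} \<and>
     group_action C X \<phi> \<and>
     (\<forall>i. 0 \<le> Polynomial.coeff f i) \<and> poly f 1 = int (card X) \<and>
     (\<forall>\<zeta>. primitive_root_of_unity (Coset.order C) \<zeta> \<longrightarrow>
        (\<forall>j::int. of_nat (card {x \<in> X. \<phi> (c [^]\<^bsub>C\<^esub> j) x = x}) =
           poly (map_poly of_int f) (\<zeta> powi j)))"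

text \<open>
  The cyclic group generated by a bijection of \<open>V\<close>, and its action on a subset \<open>X\<close> by application.
  Elements of \<open>BijGroup X\<close> are extensional, hence the restriction.
\<close>

definition generated_perm_group :: "('v \<Rightarrow> 'v) \<Rightarrow> ('v \<Rightarrow> 'v) monoid" where
  "generated_perm_group f = subgroup_generated (BijGroup UNIV) {f}"

definition application_on :: "'v set \<Rightarrow> ('v \<Rightarrow> 'v) \<Rightarrow> 'v \<Rightarrow> 'v" where
  "application_on X f = restrict f X"


section \<open>Rational q-Catalan polynomials\<close>

definition q_int :: "nat \<Rightarrow> int poly" where
  "q_int k = (\<Sum>i<k. Polynomial.monom 1 i)"

definition q_fact :: "nat \<Rightarrow> int poly" where
  "q_fact k = (\<Prod>i=1..k. q_int i)"

text \<open>
  The division on \<open>int poly\<close> is only meaningful when it is exact.  That it is exact in both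
  definitions below is the content of \<open>q_binomial_exact\<close> and \<open>q_Catalan_exact\<close>.
\<close>

definition q_binomial :: "nat \<Rightarrow> nat \<Rightarrow> int poly" where
  "q_binomial k l = q_fact k div (q_fact l * q_fact (k - l))"

definition q_Catalan :: "nat \<Rightarrow> nat \<Rightarrow> int poly" where
  "q_Catalan n m = q_binomial (n + m) m div q_int (n + m)"

lemma q_int_nonzero: "0 < k \<Longrightarrow> q_int k \<noteq> 0"
proof
  assume k: "0 < k" and "q_int k = 0"
  then have "poly (q_int k) 1 = 0" by simp
  moreover have "poly (q_int k) 1 = int k"
    by (simp add: q_int_def poly_sum poly_monom)
  ultimately show False using k by simp
qed

lemma q_fact_nonzero: "q_fact k \<noteq> 0"
  by (auto simp: q_fact_def q_int_nonzero)

lemma q_fact_Suc: "q_fact (Suc k) = q_int (Suc k) * q_fact k"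
  by (simp add: q_fact_def mult.commute)

lemma q_int_add: "q_int (a + b) = q_int a + Polynomial.monom 1 a * q_int b"
proof -
  have "q_int (a + b) = q_int a + (\<Sum>i<b. Polynomial.monom 1 (a + i))"
    by (induction b) (simp_all add: q_int_def)
  then show ?thesis
    by (simp add: q_int_def sum_distrib_left mult_monom)
qed

lemma q_fact_dvd: "q_fact a * q_fact b dvd q_fact (a + b)"
proof (induction "a + b" arbitrary: a b)
  case (Suc s)
  show ?case
  proof (cases "a = 0 \<or> b = 0")
    case True
    then show ?thesis by (auto simp: q_fact_def)
  next
    case False
    then obtain a' b' where ab: "a = Suc a'" "b = Suc b'" by (metis not0_implies_Suc)
    have s: "s = a' + b" "s = a + b'" using Suc(2) ab by auto
    have eq: "q_fact (a + b) =
        q_int a * q_fact (a' + b) + Polynomial.monom 1 a * q_int b * q_fact (a + b')"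
      using s Suc(2) by (metis q_fact_Suc q_int_add distrib_right)
    have "q_fact a * q_fact b dvd q_int a * q_fact (a' + b)"
      using Suc(1)[OF s(1)] ab(1) by (simp add: q_fact_Suc mult.assoc mult_dvd_mono)
    moreover have "q_fact a * q_fact b dvd Polynomial.monom 1 a * q_int b * q_fact (a + b')"
    proof -
      have "q_fact a * q_fact b = q_int b * (q_fact a * q_fact b')"
        by (simp add: ab(2) q_fact_Suc mult_ac)
      then have "q_fact a * q_fact b dvd q_int b * q_fact (a + b')"
        using mult_dvd_mono[OF dvd_refl Suc(1)[OF s(2)]] by metis
      then show ?thesis by (simp add: mult.assoc dvd_mult)
    qed
    ultimately show ?thesis unfolding eq by (rule dvd_add)
  qed
qed (simp add: q_fact_def)

lemma q_binomial_exact: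
  assumes "l \<le> k"
  shows "q_binomial k l * (q_fact l * q_fact (k - l)) = q_fact k"
  using q_fact_dvd[of l "k - l"] assms by (simp add: q_binomial_def)

lemma q_int_coprime_bezout:
  "coprime a b \<Longrightarrow> \<exists>u v. u * q_int a + v * q_int b = 1"
proof (induction "a + b" arbitrary: a b rule: less_induct)
  case less
  have base: "q_int (Suc 0) = 1" by (simp add: q_int_def)
  have step: "\<exists>u v. u * q_int a + v * q_int (a + e) = 1"
    if "\<exists>u v. u * q_int a + v * q_int e = 1" for a e
  proof -
    from that obtain u v where uv: "u * q_int a + v * q_int e = 1" by blast
    have e: "q_int e = q_int (a + e) - Polynomial.monom 1 e * q_int a"
      using q_int_add[of e a] by (simp add: add.commute)
    have "(u - v * Polynomial.monom 1 e) * q_int a + v * q_int (a + e) = 1"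
      using uv unfolding e by (simp add: algebra_simps)
    then show ?thesis by blast
  qed
  consider "a = 0" | "b = 0" | "0 < a" "a \<le> b" | "0 < b" "b \<le> a" by linarith
  then show ?case
  proof cases
    case 1
    then have "b = Suc 0" using less.prems by simp
    then show ?thesis by (intro exI[of _ 0] exI[of _ 1]) (simp add: base)
  next
    case 2
    then have "a = Suc 0" using less.prems by simp
    then show ?thesis by (intro exI[of _ 1] exI[of _ 0]) (simp add: base)
  next
    case 3
    then obtain e where e: "b = a + e" using le_Suc_ex by blast
    have "coprime a e" using less.prems e by (simp add: coprime_iff_gcd_eq_1)
    then show ?thesis using less.hyps[of a e] step[of a e] e 3 by simp
  next
    case 4
    then obtain e where e: "a = b + e" using le_Suc_ex by blast
    have "coprime b e" using less.prems e by (simp add: coprime_iff_gcd_eq_1 gcd.commute)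
    then have "\<exists>u v. u * q_int b + v * q_int a = 1"
      using less.hyps[of b e] step[of b e] e 4 by simp
    then show ?thesis by (metis add.commute)
  qed
qed

lemma q_Catalan_exact:
  assumes "coprime n m" "0 < m"
  shows "q_int (n + m) * q_Catalan n m = q_binomial (n + m) m"
proof -
  obtain k where m: "m = Suc k" using \<open>0 < m\<close> gr0_implies_Suc by blast
  have "q_binomial (n + m) m * q_int m * (q_fact k * q_fact n) = q_fact (n + m)"
    using q_binomial_exact[of m "n + m"] by (simp add: m q_fact_Suc mult_ac)
  also have "\<dots> = q_int (n + m) * q_binomial (n + k) k * (q_fact k * q_fact n)"
    using q_binomial_exact[of k "n + k"] by (simp add: m q_fact_Suc mult_ac)
  finally have eq: "q_binomial (n + m) m * q_int m = q_int (n + m) * q_binomial (n + k) k"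
    by (simp add: q_fact_nonzero)
  have "coprime (n + m) m" using assms(1) by (simp add: coprime_iff_gcd_eq_1)
  then obtain u v where uv: "u * q_int (n + m) + v * q_int m = 1"
    using q_int_coprime_bezout by blast
  have "q_binomial (n + m) m = q_binomial (n + m) m * (u * q_int (n + m) + v * q_int m)"
    by (simp add: uv)
  also have "\<dots> = q_int (n + m) * (u * q_binomial (n + m) m)
      + v * (q_binomial (n + m) m * q_int m)"
    by (simp add: algebra_simps)
  also have "\<dots> = q_int (n + m) * (u * q_binomial (n + m) m + v * q_binomial (n + k) k)"
    unfolding eq by (simp add: algebra_simps)
  finally have "q_int (n + m) dvd q_binomial (n + m) m" by (rule dvdI)
  then show ?thesis by (simp add: q_Catalan_def)
qed

end

theory Submission
  imports
    Defs
    "HOL-Combinatorics.Transposition"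
    "HOL-Computational_Algebra.Polynomial_FPS"
    "HOL-Number_Theory.Cong"
begin

text \<open>
  Lattice points of the \<open>m\<close>-th dilate are the multisets of size \<open>m\<close> in \<open>G\<close> with zero sum.  Let \<open>a\<close>
  be a power of \<open>c\<close>, of order \<open>e\<close>, and \<open>z\<close> the corresponding primitive \<open>e\<close>-th root of unity.  By
  semiregularity \<open>n = 1 + e A\<close>, and the multisets fixed by \<open>a\<close> have the generating function
  \<open>1 / ((1 - X) (1 - X ^ e) ^ A)\<close>, which is the product of the \<open>1 / (1 - z ^ i X)\<close> over \<open>i < n\<close>,
  whose coefficients are the \<open>q\<close>-binomials \<open>n + m - 1\<close> over \<open>m\<close> at \<open>q = z\<close>, that is
  \<open>[n]\<^sub>q Cat(q)\<close> at \<open>q = z\<close>.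
  If \<open>e > 1\<close>, then \<open>[n]\<^sub>q = 1\<close> at \<open>z\<close> and every fixed multiset has zero sum, because its sum is
  fixed by \<open>a\<close>.  If \<open>e = 1\<close>, then translating by \<open>h\<close> changes the sum by \<open>m h\<close>, so that by
  coprimality exactly one multiset in \<open>n\<close> has zero sum.
  The coefficients of the \<open>q\<close>-Catalan polynomial are nonnegative because the \<open>q\<close>-binomial
  coefficients are unimodal, which follows from an \<open>sl\<^sub>2\<close>-action on the subsets of \<open>{..<N}\<close>.
\<close>


section \<open>Unimodality of the q-binomial coefficients\<close>

text \<open>Gaussian elimination, one equation per induction step. It supplies a nonzero kernel
  vector of the raising operator when the target has smaller dimension than the source.\<close>

lemma homogeneous_system_nontrivial_solution:
  fixes a :: "'i \<Rightarrow> 'j \<Rightarrow> 'k::field"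
  assumes "finite I" "finite J" "card I < card J"
  obtains f where "\<exists>j\<in>J. f j \<noteq> 0" "\<And>i. i \<in> I \<Longrightarrow> (\<Sum>j\<in>J. a i j * f j) = 0"
proof -
  have "\<exists>f. (\<exists>j\<in>J. f j \<noteq> 0) \<and> (\<forall>i\<in>I. (\<Sum>j\<in>J. a i j * f j) = 0)"
    using assms
  proof (induction I arbitrary: J a rule: finite_induct)
    case empty
    then obtain j where "j \<in> J" by fastforce
    then show ?case by (intro exI[of _ "\<lambda>_. 1"]) auto
  next
    case (insert i0 I)
    show ?case
    proof (cases "\<forall>j\<in>J. a i0 j = 0")
      case True
      have "card I < card J" using insert by simp
      with insert.IH[of J a] insert.prems obtain f
        where "\<exists>j\<in>J. f j \<noteq> 0" "\<forall>i\<in>I. (\<Sum>j\<in>J. a i j * f j) = 0" by blast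
      with True show ?thesis by (intro exI[of _ f]) simp
    next
      case False
      then obtain j0 where j0: "j0 \<in> J" "a i0 j0 \<noteq> 0" by blast
      \<comment> \<open>Equation \<open>i0\<close> with pivot \<open>j0\<close> eliminates the
        variable \<open>j0\<close> from the other equations; \<open>g\<close> below recovers its
        value by back substitution.\<close>
      define b where "b i j = a i j - a i j0 * a i0 j / a i0 j0" for i j
      have "card I < card (J - {j0})" using insert j0 by simp
      with insert.IH[of "J - {j0}" b] insert.prems obtain f
        where f: "\<exists>j\<in>J - {j0}. f j \<noteq> 0" "\<forall>i\<in>I. (\<Sum>j\<in>J - {j0}. b i j * f j) = 0" by blast
      define g where "g j = (if j = j0 then - (\<Sum>j\<in>J - {j0}. a i0 j * f j) / a i0 j0 else f j)" for j
      have sum: "(\<Sum>j\<in>J. a i j * g j) = a i j0 * g j0 + (\<Sum>j\<in>J - {j0}. a i j * f j)" for i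
        using insert.prems(1) j0(1)
        by (simp add: sum.remove[of J j0]) (auto simp: g_def intro!: sum.cong)
      have "(\<Sum>j\<in>J. a i0 j * g j) = 0" unfolding sum using j0 by (simp add: g_def)
      moreover have "(\<Sum>j\<in>J. a i j * g j) = 0" if "i \<in> I" for i
      proof -
        have "(\<Sum>j\<in>J - {j0}. b i j * f j)
            = (\<Sum>j\<in>J - {j0}. a i j * f j) - a i j0 / a i0 j0 * (\<Sum>j\<in>J - {j0}. a i0 j * f j)"
          by (simp add: b_def algebra_simps sum_subtractf sum_distrib_left)
        with f(2) that show ?thesis unfolding sum by (simp add: g_def)
      qed
      moreover have "\<exists>j\<in>J. g j \<noteq> 0" using f(1) by (auto simp: g_def)
      ultimately show ?thesis by (intro exI[of _ g]) simp
    qed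
  qed
  then show ?thesis using that by blast
qed

section \<open>Moves on subsets of fixed size and the raising operator\<close>

definition fixed_size_subsets :: "nat \<Rightarrow> nat \<Rightarrow> nat set set" where
  "fixed_size_subsets N m = {S. S \<subseteq> {..<N} \<and> card S = m}"

lemma finite_fixed_size_subsets [simp]: "finite (fixed_size_subsets N m)"
  by (rule finite_subset[of _ "Pow {..<N}"]) (auto simp: fixed_size_subsets_def)

text \<open>Moving an element to a neighbouring place is encoded by a transposition. This makes the
  move a total involution, so sums over subsets can be reindexed along it even where the move is not
  possible.\<close>

definition swap_Suc :: "nat \<Rightarrow> nat set \<Rightarrow> nat set" where
  "swap_Suc i S = transpose i (Suc i) ` S"

lemma mem_swap_Suc: "x \<in> swap_Suc i S \<longleftrightarrow> transpose i (Suc i) x \<in> S"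
  unfolding swap_Suc_def by (metis image_iff transpose_involutory)

lemma swap_Suc_involutory [simp]: "swap_Suc i (swap_Suc i S) = S"
  by (auto simp: mem_swap_Suc)

lemma swap_Suc_commute:
  assumes "Suc i < j \<or> Suc j < i"
  shows "swap_Suc i (swap_Suc j S) = swap_Suc j (swap_Suc i S)"
  using assms by (auto simp: mem_swap_Suc transpose_def split: if_splits)

lemma swap_Suc_in_fixed_size_subsets:
  assumes "Suc i < N" "S \<in> fixed_size_subsets N m"
  shows "swap_Suc i S \<in> fixed_size_subsets N m"
proof -
  have "card (swap_Suc i S) = card S"
    unfolding swap_Suc_def by (intro card_image inj_on_subset[OF inj_transpose]) simp
  then show ?thesis
    using assms by (auto simp: fixed_size_subsets_def swap_Suc_def transpose_def)
qed

lemma bij_betw_swap_Suc: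
  assumes "Suc i < N"
  shows "bij_betw (swap_Suc i) (fixed_size_subsets N m) (fixed_size_subsets N m)"
  by (rule bij_betw_byWitness[of _ "swap_Suc i"])
    (use assms in \<open>auto simp: swap_Suc_in_fixed_size_subsets\<close>)

lemma sum_swap_Suc:
  assumes "finite S" "i \<in> S" "Suc i \<notin> S"
  shows "\<Sum>(swap_Suc i S) = Suc (\<Sum>S)"
proof -
  have "swap_Suc i S = insert (Suc i) (S - {i})"
    using assms by (auto simp: mem_swap_Suc transpose_def split: if_splits)
  moreover have "\<Sum>(insert (Suc i) (S - {i})) = Suc i + \<Sum>(S - {i})"
    using assms by (subst sum.insert) auto
  ultimately show ?thesis using assms sum.remove[of S i "\<lambda>x. x"] by simp
qed

text \<open>
  The raising and lowering operators of the \<open>m\<close>-th exterior power of the irreducible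
  \<open>N\<close>-dimensional representation of \<open>sl\<^sub>2\<close>, in an orthonormal basis.  The basis vector of \<open>S\<close>
  changes by moving one element of \<open>S\<close> to an adjacent free place, so no signs occur.
\<close>

definition raise_weight :: "nat \<Rightarrow> nat \<Rightarrow> real" where
  "raise_weight N i = real (Suc i) * (real N - 1 - real i)"

definition raise_op :: "nat \<Rightarrow> (nat set \<Rightarrow> real) \<Rightarrow> nat set \<Rightarrow> real" where
  "raise_op N f S = (\<Sum>i<N-1. if i \<notin> S \<and> Suc i \<in> S then sqrt (raise_weight N i) * f (swap_Suc i S) else 0)"

definition lower_op :: "nat \<Rightarrow> (nat set \<Rightarrow> real) \<Rightarrow> nat set \<Rightarrow> real" where
  "lower_op N f S = (\<Sum>i<N-1. if i \<in> S \<and> Suc i \<notin> S then sqrt (raise_weight N i) * f (swap_Suc i S) else 0)"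

text \<open>Summation by parts: the difference of indicators is
  \<open>of_bool (i \<in> S) - of_bool (Suc i \<in> S)\<close>, and consecutive weights differ by
  \<open>N - 1 - 2 * i\<close>.\<close>

lemma sum_raise_weight:
  assumes "S \<subseteq> {..<N}"
  shows "(\<Sum>i<N-1. raise_weight N i * (of_bool (i \<in> S \<and> Suc i \<notin> S) - of_bool (i \<notin> S \<and> Suc i \<in> S)))
    = real (card S) * (real N - 1) - 2 * real (\<Sum>S)"
proof -
  have fin: "finite S" using assms finite_subset by blast
  \<comment> \<open>The partial sums carry a boundary term. At \<open>M = N - 1\<close> it vanishes,
    because the weight is zero there or, for \<open>N = 0\<close>, because \<open>S\<close> is
    empty.\<close>
  have "(\<Sum>i<M. raise_weight N i * (of_bool (i \<in> S \<and> Suc i \<notin> S) - of_bool (i \<notin> S \<and> Suc i \<in> S)))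
     = (\<Sum>i\<le>M. of_bool (i \<in> S) * (real N - 1 - 2 * real i))  - raise_weight N M * of_bool (M \<in> S)" for M
  proof (induction M)
    case (Suc M)
    then show ?case
      by (cases "M \<in> S"; cases "Suc M \<in> S") (simp_all add: raise_weight_def algebra_simps)
  qed (simp add: raise_weight_def)
  from this[of "N-1"]
  have "(\<Sum>i<N-1. raise_weight N i * (of_bool (i \<in> S \<and> Suc i \<notin> S) - of_bool (i \<notin> S \<and> Suc i \<in> S)))
     = (\<Sum>i\<le>N-1. of_bool (i \<in> S) * (real N - 1 - 2 * real i))"
    using assms by (cases N) (auto simp: raise_weight_def)
  also have "\<dots> = (\<Sum>i\<in>S. real N - 1 - 2 * real i)"
    using assms by (intro sum.mono_neutral_cong_right) auto
  also have "\<dots> = real (card S) * (real N - 1) - 2 * real (\<Sum>S)"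
    by (simp add: sum_subtractf sum_distrib_left of_nat_sum)
  finally show ?thesis .
qed

text \<open>
  In operator form: raising and lowering are adjoint and their commutator is the weight operator.
\<close>

lemma raise_lower_norm_difference:
  "(\<Sum>S\<in>fixed_size_subsets N m. (raise_op N f S)\<^sup>2) - (\<Sum>S\<in>fixed_size_subsets N m. (lower_op N f S)\<^sup>2)
   = (\<Sum>S\<in>fixed_size_subsets N m. (real m * (real N - 1) - 2 * real (\<Sum>S)) * (f S)\<^sup>2)"
proof -
  let ?F = "fixed_size_subsets N m" and ?w = "raise_weight N"
  define P where "P i S \<longleftrightarrow> i \<in> S \<and> Suc i \<notin> S" for i and S :: "nat set"
  define Q where "Q i S \<longleftrightarrow> i \<notin> S \<and> Suc i \<in> S" for i and S :: "nat set"
  \<comment> \<open>\<open>r\<close> and \<open>l\<close> are the \<open>(i, j)\<close> terms of the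
    squared operators. Off the diagonal their sums over all subsets agree, so only
    \<open>i = j\<close> contributes to the difference.\<close>
  define r where "r i j S = (if Q i S \<and> Q j S
      then sqrt (?w i) * sqrt (?w j) * (f (swap_Suc i S) * f (swap_Suc j S)) else 0)" for i j S
  define l where "l i j S = (if P i S \<and> P j S
      then sqrt (?w i) * sqrt (?w j) * (f (swap_Suc i S) * f (swap_Suc j S)) else 0)" for i j S
  have PQ: "P i (swap_Suc i S) \<longleftrightarrow> Q i S" "Q i (swap_Suc i S) \<longleftrightarrow> P i S" for i S
    by (auto simp: P_def Q_def mem_swap_Suc)
  have raise: "(raise_op N f S)\<^sup>2 = (\<Sum>i<N-1. \<Sum>j<N-1. r i j S)" for S
    unfolding raise_op_def power2_eq_square sum_product r_def Q_def
    by (intro sum.cong refl) (auto simp: algebra_simps)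
  have lower: "(lower_op N f S)\<^sup>2 = (\<Sum>i<N-1. \<Sum>j<N-1. l i j S)" for S
    unfolding lower_op_def power2_eq_square sum_product l_def P_def
    by (intro sum.cong refl) (auto simp: algebra_simps)
  have offdiag: "(\<Sum>S\<in>?F. r i j S) = (\<Sum>S\<in>?F. l i j S)" if ij: "i < N - 1" "j < N - 1" "i \<noteq> j" for i j
  proof (cases "Suc i < j \<or> Suc j < i")
    case True
    \<comment> \<open>For distant places, performing both moves exchanges the conditions
      \<open>Q\<close> and \<open>P\<close>, hence raising and lowering terms.\<close>
    let ?h = "\<lambda>S. swap_Suc i (swap_Suc j S)"
    have "bij_betw (swap_Suc i \<circ> swap_Suc j) ?F ?F"
      by (rule bij_betw_trans; rule bij_betw_swap_Suc) (use ij in auto)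
    then have "(\<Sum>S\<in>?F. r i j (?h S)) = (\<Sum>S\<in>?F. r i j S)"
      using sum.reindex_bij_betw[of "swap_Suc i \<circ> swap_Suc j" ?F ?F "r i j"] by simp
    moreover have "r i j (?h S) = l i j S" for S
    proof -
      have "Q i (?h S) \<longleftrightarrow> P i S" "Q j (?h S) \<longleftrightarrow> P j S"
        using True by (auto simp: P_def Q_def mem_swap_Suc transpose_def)
      moreover have "swap_Suc j (?h S) = swap_Suc i S" using swap_Suc_commute[OF True] by simp
      ultimately show ?thesis by (simp add: r_def l_def)
    qed
    ultimately show ?thesis by simp
  next
    case False
    \<comment> \<open>For neighbouring places the two conditions disagree about the shared place, so
      both terms are zero.\<close>
    then have "j = Suc i \<or> i = Suc j" using ij by linarith
    then have "r i j S = 0" "l i j S = 0" for S by (auto simp: r_def l_def P_def Q_def)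
    then show ?thesis by simp
  qed
  have w: "0 \<le> ?w i" if "i < N - 1" for i using that by (auto simp: raise_weight_def)
  have diag: "(\<Sum>S\<in>?F. r i i S) - (\<Sum>S\<in>?F. l i i S)
      = (\<Sum>S\<in>?F. ?w i * (of_bool (P i S) - of_bool (Q i S)) * (f S)\<^sup>2)" if i: "i < N - 1" for i
  proof -
    \<comment> \<open>Reindexing by the move itself turns \<open>f (swap_Suc i S)\<close> back into
      \<open>f S\<close> and exchanges \<open>P\<close> and \<open>Q\<close>.\<close>
    have b: "bij_betw (swap_Suc i) ?F ?F" using i bij_betw_swap_Suc by auto
    have "(\<Sum>S\<in>?F. r i i S) = (\<Sum>S\<in>?F. ?w i * of_bool (P i S) * (f S)\<^sup>2)"
      using w[OF i] by (subst sum.reindex_bij_betw[OF b, symmetric])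
        (auto intro!: sum.cong simp: r_def PQ power2_eq_square)
    moreover have "(\<Sum>S\<in>?F. l i i S) = (\<Sum>S\<in>?F. ?w i * of_bool (Q i S) * (f S)\<^sup>2)"
      using w[OF i] by (subst sum.reindex_bij_betw[OF b, symmetric])
        (auto intro!: sum.cong simp: l_def PQ power2_eq_square)
    ultimately show ?thesis by (simp add: sum_subtractf algebra_simps)
  qed
  have "(\<Sum>S\<in>?F. (raise_op N f S)\<^sup>2) - (\<Sum>S\<in>?F. (lower_op N f S)\<^sup>2)
      = (\<Sum>i<N-1. \<Sum>j<N-1. (\<Sum>S\<in>?F. r i j S) - (\<Sum>S\<in>?F. l i j S))"
    unfolding raise lower sum_subtractf
    by (simp add: sum.swap[of _ ?F])
  also have "\<dots> = (\<Sum>i<N-1. \<Sum>j<N-1. if j = i then (\<Sum>S\<in>?F. r i i S) - (\<Sum>S\<in>?F. l i i S) else 0)"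
    using offdiag by (intro sum.cong refl) auto
  also have "\<dots> = (\<Sum>i<N-1. \<Sum>S\<in>?F. ?w i * (of_bool (P i S) - of_bool (Q i S)) * (f S)\<^sup>2)"
    using diag by (intro sum.cong refl) (simp add: sum.delta')
  also have "\<dots> = (\<Sum>S\<in>?F. (\<Sum>i<N-1. ?w i * (of_bool (P i S) - of_bool (Q i S))) * (f S)\<^sup>2)"
    by (subst sum.swap) (simp add: sum_distrib_right)
  also have "\<dots> = (\<Sum>S\<in>?F. (real m * (real N - 1) - 2 * real (\<Sum>S)) * (f S)\<^sup>2)"
    unfolding P_def Q_def
    by (intro sum.cong refl, subst sum_raise_weight) (auto simp: fixed_size_subsets_def)
  finally show ?thesis .
qed

definition subsets_of_sum :: "nat \<Rightarrow> nat \<Rightarrow> nat \<Rightarrow> nat set set" where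
  "subsets_of_sum N m k = {S \<in> fixed_size_subsets N m. \<Sum>S = k}"

text \<open>Below the middle, the raising operator from sum \<open>k\<close> to sum
  \<open>Suc k\<close> is injective. For a nonzero \<open>g\<close> in its kernel,
  \<open>raise_lower_norm_difference\<close> would equate a positive multiple of the squared norm of
  \<open>g\<close> with minus that of \<open>lower_op N g\<close>.\<close>

lemma card_subsets_of_sum_mono:
  assumes "2 * k < m * (N - 1)"
  shows "card (subsets_of_sum N m k) \<le> card (subsets_of_sum N m (Suc k))"
proof (rule ccontr)
  let ?F = "fixed_size_subsets N m" and ?A = "subsets_of_sum N m"
  assume "\<not> ?thesis"
  then have less: "card (?A (Suc k)) < card (?A k)" by simp
  have fin: "finite (?A j)" for j by (simp add: subsets_of_sum_def)
  \<comment> \<open>\<open>a\<close> is the matrix of \<open>raise_op\<close> from the subsets of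
    sum \<open>k\<close> to those of sum \<open>Suc k\<close>; \<open>g\<close> below extends the
    kernel vector by zero.\<close>
  define a where "a S R = (\<Sum>i<N-1. if i \<notin> S \<and> Suc i \<in> S \<and> swap_Suc i S = R then sqrt (raise_weight N i) else 0)" for S R
  obtain f where f: "\<exists>R\<in>?A k. f R \<noteq> 0" "\<And>S. S \<in> ?A (Suc k) \<Longrightarrow> (\<Sum>R\<in>?A k. a S R * f R) = 0"
    using homogeneous_system_nontrivial_solution[OF fin fin less] by blast
  define g where "g R = (if R \<in> ?A k then f R else 0)" for R
  have "raise_op N g S = 0" if S: "S \<in> ?F" for S
  proof (cases "\<Sum>S = Suc k")
    case True
    have "raise_op N g S = (\<Sum>i<N-1. \<Sum>R\<in>?A k. (if i \<notin> S \<and> Suc i \<in> S \<and> swap_Suc i S = R then sqrt (raise_weight N i) else 0) * f R)"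
      unfolding raise_op_def
    proof (intro sum.cong refl)
      fix i
      have "(\<Sum>R\<in>?A k. (if i \<notin> S \<and> Suc i \<in> S \<and> swap_Suc i S = R then sqrt (raise_weight N i) else 0) * f R)
         = (\<Sum>R\<in>?A k. if R = swap_Suc i S then (if i \<notin> S \<and> Suc i \<in> S then sqrt (raise_weight N i) * f R else 0) else 0)"
        by (intro sum.cong) auto
      also have "\<dots> = (if i \<notin> S \<and> Suc i \<in> S then sqrt (raise_weight N i) * g (swap_Suc i S) else 0)"
        using fin by (simp add: sum.delta' g_def)
      finally show "(if i \<notin> S \<and> Suc i \<in> S then sqrt (raise_weight N i) * g (swap_Suc i S) else 0)
        = (\<Sum>R\<in>?A k. (if i \<notin> S \<and> Suc i \<in> S \<and> swap_Suc i S = R then sqrt (raise_weight N i) else 0) * f R)" ..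
    qed
    also have "\<dots> = (\<Sum>R\<in>?A k. a S R * f R)"
      by (subst sum.swap) (simp add: a_def sum_distrib_right)
    also have "\<dots> = 0" using f(2) S True by (simp add: subsets_of_sum_def)
    finally show ?thesis .
  next
    case False
    \<comment> \<open>The sets that contribute to the value at \<open>S\<close> here have a sum
      other than \<open>k\<close>, and \<open>g\<close> vanishes on them.\<close>
    have "g (swap_Suc i S) = 0" if i: "i \<notin> S" "Suc i \<in> S" for i
    proof -
      have "finite (swap_Suc i S)" using S finite_subset
        by (auto simp: fixed_size_subsets_def swap_Suc_def)
      then have "\<Sum>S = Suc (\<Sum>(swap_Suc i S))"
        using sum_swap_Suc[of "swap_Suc i S" i] i by (simp add: mem_swap_Suc)
      then show ?thesis using False by (auto simp: g_def subsets_of_sum_def)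
    qed
    then show ?thesis unfolding raise_op_def by (intro sum.neutral) auto
  qed
  then have "(\<Sum>S\<in>?F. (real m * (real N - 1) - 2 * real (\<Sum>S)) * (g S)\<^sup>2) \<le> 0"
    using raise_lower_norm_difference[of N g m, symmetric] by (simp add: sum_nonneg)
  also have "(\<Sum>S\<in>?F. (real m * (real N - 1) - 2 * real (\<Sum>S)) * (g S)\<^sup>2)
      = (real m * (real N - 1) - 2 * real k) * (\<Sum>S\<in>?F. (g S)\<^sup>2)"
    unfolding sum_distrib_left by (intro sum.cong) (auto simp: g_def subsets_of_sum_def)
  finally have le: "(real m * (real N - 1) - 2 * real k) * (\<Sum>S\<in>?F. (g S)\<^sup>2) \<le> 0" .
  have "N > 0" using assms by (cases N) auto
  then have "real m * (real N - 1) = real (m * (N - 1))" by (simp add: of_nat_diff)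
  then have "real m * (real N - 1) - 2 * real k > 0" using assms by linarith
  with le have "(\<Sum>S\<in>?F. (g S)\<^sup>2) \<le> 0" by (simp add: mult_le_0_iff)
  then have "\<forall>S\<in>?F. (g S)\<^sup>2 = 0"
    by (subst sum_nonneg_eq_0_iff[symmetric]) (auto intro!: antisym sum_nonneg)
  then show False using f(1) by (auto simp: g_def subsets_of_sum_def)
qed

section \<open>Subset-sum generating functions and q-binomial coefficients\<close>

lemma sum_fixed_size_subsets_Suc:
  fixes h :: "nat set \<Rightarrow> 'b::comm_monoid_add"
  shows "sum h (fixed_size_subsets (Suc N) (Suc m))
    = sum h (fixed_size_subsets N (Suc m)) + (\<Sum>S\<in>fixed_size_subsets N m. h (insert N S))"
proof -
  let ?F = fixed_size_subsets
  have fin: "finite S" if "S \<subseteq> {..<N}" for S using that finite_subset by blast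
  have eq: "?F (Suc N) (Suc m) = ?F N (Suc m) \<union> insert N ` ?F N m"
  proof (intro equalityI subsetI)
    fix S assume S: "S \<in> ?F (Suc N) (Suc m)"
    then have sub: "S \<subseteq> insert N {..<N}" "card S = Suc m" by (auto simp: fixed_size_subsets_def lessThan_Suc)
    show "S \<in> ?F N (Suc m) \<union> insert N ` ?F N m"
    proof (cases "N \<in> S")
      case True
      then have "S = insert N (S - {N})" "S - {N} \<in> ?F N m"
        using sub by (auto simp: fixed_size_subsets_def)
      then show ?thesis by blast
    next
      case False
      then show ?thesis using sub by (auto simp: fixed_size_subsets_def)
    qed
  next
    fix S assume "S \<in> ?F N (Suc m) \<union> insert N ` ?F N m"
    then show "S \<in> ?F (Suc N) (Suc m)"
      using fin by (auto simp: fixed_size_subsets_def card_insert_if)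
  qed
  have "inj_on (insert N) (?F N m)"
    by (rule inj_onI) (auto simp: fixed_size_subsets_def dest!: insert_ident[THEN iffD1, rotated 2])
  moreover have "?F N (Suc m) \<inter> insert N ` ?F N m = {}" by (auto simp: fixed_size_subsets_def)
  ultimately show ?thesis unfolding eq by (simp add: sum.union_disjoint sum.reindex)
qed

text \<open>This is the elementary symmetric polynomial of degree \<open>m\<close> in
  \<open>1, q, ..., q ^ (N - 1)\<close>. It is a shifted q-binomial coefficient, which links the
  counts of subsets to the q-binomials.\<close>

definition subset_sum_poly :: "nat \<Rightarrow> nat \<Rightarrow> int poly" where
  "subset_sum_poly N m = (\<Sum>S\<in>fixed_size_subsets N m. Polynomial.monom 1 (\<Sum>S))"

lemma coeff_subset_sum_poly: "Polynomial.coeff (subset_sum_poly N m) k = int (card (subsets_of_sum N m k))"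
  by (simp add: subset_sum_poly_def coeff_sum subsets_of_sum_def sum.inter_filter[symmetric])

lemma subset_sum_poly_0: "subset_sum_poly N 0 = 1"
proof -
  have "fixed_size_subsets N 0 = {{}}"
    using finite_subset[of _ "{..<N}"] by (auto simp: fixed_size_subsets_def)
  then show ?thesis by (simp add: subset_sum_poly_def)
qed

lemma subset_sum_poly_Suc:
  "subset_sum_poly (Suc N) (Suc m) = subset_sum_poly N (Suc m) + Polynomial.monom 1 N * subset_sum_poly N m"
proof -
  have "Polynomial.monom (1::int) (\<Sum>(insert N S)) = Polynomial.monom 1 N * Polynomial.monom 1 (\<Sum>S)"
    if "S \<in> fixed_size_subsets N m" for S
  proof -
    have "finite S" "N \<notin> S" using that finite_subset[of S "{..<N}"] by (auto simp: fixed_size_subsets_def)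
    then show ?thesis by (simp add: mult_monom)
  qed
  then show ?thesis
    by (simp add: subset_sum_poly_def sum_fixed_size_subsets_Suc sum_distrib_left)
qed

lemma subset_sum_poly_less:
  assumes "N < m"
  shows "subset_sum_poly N m = 0"
proof -
  have "card S \<noteq> m" if "S \<subseteq> {..<N}" for S
    using card_mono[OF finite_lessThan that] assms by simp
  then have "fixed_size_subsets N m = {}" unfolding fixed_size_subsets_def by blast
  then show ?thesis by (simp add: subset_sum_poly_def)
qed

text \<open>The recurrence \<open>subset_sum_poly_Suc\<close> matches the splitting of
  \<open>q_int (l + m)\<close> by \<open>q_int_add\<close>. The factorials stay multiplied out, so
  no division occurs in the induction.\<close>

lemma subset_sum_poly_q_fact:
  "subset_sum_poly (l + m) m * (q_fact m * q_fact l) = Polynomial.monom 1 (m choose 2) * q_fact (l + m)"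
proof (induction "l + m" arbitrary: l m)
  case 0
  then show ?case by (simp add: subset_sum_poly_0 q_fact_def binomial_eq_0)
next
  case (Suc N)
  show ?case
  proof (cases m)
    case 0
    then show ?thesis by (simp add: subset_sum_poly_0 q_fact_def binomial_eq_0)
  next
    case m: (Suc m')
    have N: "N = l + m'" using Suc.hyps(2) m by simp
    note IH2 = Suc.hyps(1)[OF N]
    have IH1: "subset_sum_poly N m * (q_fact m * q_fact l)
        = Polynomial.monom 1 (m choose 2) * (q_int l * q_fact N)"
    \<comment> \<open>For \<open>l = 0\<close> no smaller instance applies, but both sides vanish,
      since \<open>N < m\<close> and \<open>q_int 0 = 0\<close>.\<close>
    proof (cases l)
      case 0
      then show ?thesis using N m by (simp add: subset_sum_poly_less q_int_def)
    next
      case (Suc l')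
      then have N': "N = l' + m" using N m by simp
      show ?thesis using Suc.hyps(1)[OF N'] by (simp add: N' [symmetric] Suc q_fact_Suc mult_ac)
    qed
    have ch: "m choose 2 = m' + (m' choose 2)" by (simp add: m numeral_2_eq_2)
    have mon: "Polynomial.monom (1::int) N * Polynomial.monom 1 (m' choose 2)
       = Polynomial.monom 1 (m choose 2) * Polynomial.monom 1 l"
      by (simp add: mult_monom ch N add_ac)
    have "subset_sum_poly (l + m) m * (q_fact m * q_fact l)
       = subset_sum_poly N m * (q_fact m * q_fact l)
         + Polynomial.monom 1 N * q_int m * (subset_sum_poly N m' * (q_fact m' * q_fact l))"
      unfolding Suc.hyps(2)[symmetric] unfolding m subset_sum_poly_Suc
      by (simp add: q_fact_Suc algebra_simps)
    also have "\<dots> = Polynomial.monom 1 (m choose 2) * ((q_int l + Polynomial.monom 1 l * q_int m) * q_fact N)"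
    proof -
      have "Polynomial.monom 1 N * q_int m * (Polynomial.monom 1 (m' choose 2) * q_fact N)
          = (Polynomial.monom 1 N * Polynomial.monom 1 (m' choose 2)) * (q_int m * q_fact N)"
        by (simp only: mult_ac)
      then show ?thesis
        unfolding IH1 IH2[folded N] mon by (simp only: algebra_simps)
    qed
    also have "\<dots> = Polynomial.monom 1 (m choose 2) * q_fact (l + m)"
      unfolding q_int_add[symmetric] Suc.hyps(2)[symmetric] q_fact_Suc ..
    finally show ?thesis .
  qed
qed

lemma subset_sum_poly_eq_q_binomial:
  "subset_sum_poly (n + m) m = Polynomial.monom 1 (m choose 2) * q_binomial (n + m) m"
proof -
  have "subset_sum_poly (n + m) m * (q_fact m * q_fact n)
      = Polynomial.monom 1 (m choose 2) * q_binomial (n + m) m * (q_fact m * q_fact n)"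
    using subset_sum_poly_q_fact[of n m] q_binomial_exact[of m "n + m"] by (simp add: mult_ac)
  then show ?thesis by (simp add: q_fact_nonzero)
qed

lemma two_times_choose_two: "2 * (k choose 2) = k * (k - 1)"
  by (cases k) (simp_all add: choose_two)

text \<open>The shift by \<open>m choose 2\<close> turns degree \<open>k\<close> into subset sum
  \<open>(m choose 2) + k\<close>, and \<open>2 * k < n * m\<close> into the hypothesis of
  \<open>card_subsets_of_sum_mono\<close> for subsets of \<open>{..<n + m}\<close>.\<close>

lemma coeff_q_binomial_mono:
  assumes "2 * k < n * m"
  shows "Polynomial.coeff (q_binomial (n + m) m) k \<le> Polynomial.coeff (q_binomial (n + m) m) (Suc k)"
proof -
  let ?c = "m choose 2"
  have co: "Polynomial.coeff (q_binomial (n + m) m) j = int (card (subsets_of_sum (n + m) m (?c + j)))" for j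
    unfolding coeff_subset_sum_poly[symmetric] subset_sum_poly_eq_q_binomial
    by (simp add: coeff_monom_mult)
  have "2 * (?c + k) = m * (m - 1) + 2 * k" using two_times_choose_two[of m] by simp
  also have "\<dots> < m * (m - 1) + n * m" using assms by simp
  also have "\<dots> = m * (n + m - 1)" 
  proof -
    have "m * (n + m - 1) = n * m + m * (m - 1)"
    by (cases m) (auto simp: algebra_simps)
    then show ?thesis by simp
  qed
  finally have "2 * (?c + k) < m * (n + m - 1)" .
  from card_subsets_of_sum_mono[OF this] show ?thesis unfolding co by simp
qed


section \<open>Nonnegativity of the rational q-Catalan polynomials\<close>

lemma degree_q_int: "0 < k \<Longrightarrow> degree (q_int k) = k - 1"
  and coeff_q_int: "Polynomial.coeff (q_int k) i = of_bool (i < k)"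
proof -
  show c: "Polynomial.coeff (q_int k) i = of_bool (i < k)" for i
    by (simp add: q_int_def coeff_sum)
  show "degree (q_int k) = k - 1" if "0 < k"
    using that by (intro antisym degree_le le_degree) (auto simp: c)
qed

lemma reflect_q_int: "reflect_poly (q_int k) = q_int k"
proof (cases "k = 0")
  case False
  then show ?thesis
    by (intro poly_eqI) (auto simp: coeff_reflect_poly degree_q_int coeff_q_int)
qed (simp add: q_int_def)

lemma reflect_q_fact: "reflect_poly (q_fact k) = q_fact k"
  by (induction k) (simp_all add: q_fact_Suc reflect_poly_mult reflect_q_int, simp add: q_fact_def)

lemma degree_q_fact: "degree (q_fact k) = k choose 2"
proof (induction k)
  case (Suc k)
  then show ?case
    by (simp add: q_fact_Suc degree_mult_eq q_int_nonzero q_fact_nonzero degree_q_int numeral_2_eq_2)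
qed (simp add: q_fact_def)

text \<open>The division-free form from which symmetry and degree follow by cancelling
  q-factorials.\<close>

lemma q_Catalan_q_fact:
  assumes "coprime n m" "0 < m"
  shows "q_Catalan n m * (q_fact m * q_fact n) = q_fact (n + m - 1)"
proof -
  obtain N where N: "n + m = Suc N" using assms(2) by (cases "n + m") auto
  have "q_int (n + m) * (q_Catalan n m * (q_fact m * q_fact n)) = q_int (n + m) * q_fact N"
    using q_binomial_exact[of m "n + m"]
    by (simp add: q_Catalan_exact[OF assms, symmetric] N[symmetric] mult_ac) (simp add: N q_fact_Suc mult_ac)
  then show ?thesis using q_int_nonzero[of "n + m"] N by simp
qed

text \<open>The q-factorials are palindromic, and an exact quotient of palindromic polynomials is
  palindromic.\<close>

lemma reflect_q_Catalan:
  assumes "coprime n m" "0 < m"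
  shows "reflect_poly (q_Catalan n m) = q_Catalan n m"
proof -
  have "reflect_poly (q_Catalan n m) * (q_fact m * q_fact n) = q_Catalan n m * (q_fact m * q_fact n)"
    using arg_cong[OF q_Catalan_q_fact[OF assms], of reflect_poly] q_Catalan_q_fact[OF assms]
    unfolding reflect_poly_mult reflect_q_fact by metis
  then show ?thesis by (simp add: q_fact_nonzero)
qed

text \<open>This coarse bound suffices for reflection to send every degree above
  \<open>n * m / 2\<close> to one below it.\<close>

lemma degree_q_Catalan_le:
  assumes "coprime n m" "0 < m"
  shows "degree (q_Catalan n m) \<le> n * m"
proof -
  have ne: "q_Catalan n m \<noteq> 0" using q_Catalan_q_fact[OF assms] q_fact_nonzero by force
  have "degree (q_Catalan n m) + ((m choose 2) + (n choose 2)) = n + m - 1 choose 2"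
    using arg_cong[OF q_Catalan_q_fact[OF assms], of degree] ne
    by (simp add: degree_mult_eq q_fact_nonzero degree_q_fact)
  also have "\<dots> \<le> n + m choose 2" by (rule binomial_right_mono) simp
  also have "\<dots> = (m choose 2) + (n choose 2) + n * m" 
  proof -
    from two_times_choose_two[of m] two_times_choose_two[of n] two_times_choose_two[of "n + m"]
    show ?thesis
      by (cases n; cases m) (auto simp: algebra_simps)
  qed
  finally show ?thesis by simp
qed

text \<open>
  Below the middle degree, \<open>(1 - q) * q_binomial (n + m) m\<close> has nonnegative coefficients by
  unimodality, and dividing by \<open>1 - q ^ (n + m)\<close> preserves this; symmetry gives the other half.
\<close>

lemma coeff_q_Catalan_nonneg:
  assumes "coprime n m" "0 < m"
  shows "0 \<le> Polynomial.coeff (q_Catalan n m) k"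
proof -
  let ?C = "q_Catalan n m" and ?B = "q_binomial (n + m) m" and ?N = "n + m"
  have N0: "0 < ?N" using assms by simp
  have q1: "(1 - Polynomial.monom 1 1) * q_int j = 1 - Polynomial.monom 1 j" for j
  proof -
    have "q_int 1 + Polynomial.monom 1 1 * q_int j = q_int j + Polynomial.monom 1 j * q_int 1"
      using q_int_add[of 1 j] q_int_add[of j 1] by simp
    then show ?thesis by (simp add: q_int_def algebra_simps)
  qed
  \<comment> \<open>Multiplication by \<open>1 - q\<close> turns the factor \<open>q_int ?N\<close>
    into \<open>1 - q ^ ?N\<close>. Comparing coefficients then gives the recurrence
    \<open>rec\<close> with step \<open>?N\<close>.\<close>
  have eq: "(1 - Polynomial.monom 1 ?N) * ?C = (1 - Polynomial.monom 1 1) * ?B"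
    by (simp only: q1[of ?N, symmetric] mult.assoc q_Catalan_exact[OF assms])
  have rec: "Polynomial.coeff ?C k = Polynomial.coeff (Polynomial.monom 1 ?N * ?C) k
      + (Polynomial.coeff ?B k - Polynomial.coeff (Polynomial.monom 1 1 * ?B) k)" for k
  proof -
    have "Polynomial.coeff ?C k - Polynomial.coeff (Polynomial.monom 1 ?N * ?C) k
        = Polynomial.coeff ?B k - Polynomial.coeff (Polynomial.monom 1 1 * ?B) k"
      using arg_cong[OF eq, of "\<lambda>p. Polynomial.coeff p k"]
      by (simp only: left_diff_distrib mult_1_left coeff_diff)
    then show ?thesis by linarith
  qed
  have B0: "0 \<le> Polynomial.coeff ?B 0"
    using coeff_subset_sum_poly[of "n+m" m "m choose 2"]
    unfolding subset_sum_poly_eq_q_binomial by (simp add: coeff_monom_mult)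
  have low: "0 \<le> Polynomial.coeff ?C k" if "2 * k \<le> n * m" for k
    using that
  proof (induction k rule: less_induct)
    case (less k)
    have 1: "0 \<le> Polynomial.coeff (Polynomial.monom 1 ?N * ?C) k"
      using less.IH[of "k - ?N"] less.prems N0 by (auto simp: coeff_monom_mult)
    have 2: "Polynomial.coeff (Polynomial.monom 1 1 * ?B) k \<le> Polynomial.coeff ?B k"
    proof (cases k)
      case (Suc k')
      then show ?thesis using coeff_q_binomial_mono[of k' n m] less.prems
        by (simp add: coeff_monom_mult)
    qed (simp add: coeff_monom_mult B0)
    show ?case using 1 2 rec[of k] by linarith
  qed
  show ?thesis
  proof (cases "2 * k \<le> n * m \<or> degree ?C < k")
    case True
    then show ?thesis using low by (auto simp: coeff_eq_0)
  next
    case False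
    have "Polynomial.coeff ?C k = Polynomial.coeff ?C (degree ?C - k)"
      using False arg_cong[OF reflect_q_Catalan[OF assms], of "\<lambda>p. Polynomial.coeff p k"]
      by (simp add: coeff_reflect_poly)
    moreover have "2 * (degree ?C - k) \<le> n * m"
      using False degree_q_Catalan_le[OF assms] by linarith
    ultimately show ?thesis using low by simp
  qed
qed


section \<open>Invariant functions and q-binomials at roots of unity\<close>

text \<open>With all weights 1 these are the multisets of size \<open>m\<close> on \<open>I\<close>;
  with orbit sizes as weights they describe invariant multisets by their values on orbits. Vanishing
  off \<open>I\<close> gives each multiset one representative.\<close>

definition weighted_solutions :: "'a set \<Rightarrow> ('a \<Rightarrow> nat) \<Rightarrow> nat \<Rightarrow> ('a \<Rightarrow> nat) set" where
  "weighted_solutions I w m = {x. (\<forall>i. i \<notin> I \<longrightarrow> x i = 0) \<and> (\<Sum>i\<in>I. w i * x i) = m}"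

lemma finite_weighted_solutions:
  assumes "finite I" "\<And>i. i \<in> I \<Longrightarrow> 0 < w i"
  shows "finite (weighted_solutions I w m)"
proof (rule finite_subset)
  show "weighted_solutions I w m \<subseteq> {x. \<forall>i. (i \<in> I \<longrightarrow> x i \<in> {..m}) \<and> (i \<notin> I \<longrightarrow> x i = 0)}"
  proof safe
    fix x i assume x: "x \<in> weighted_solutions I w m" and i: "i \<in> I"
    have "x i \<le> w i * x i" using assms(2)[OF i] by simp
    also have "\<dots> \<le> (\<Sum>i\<in>I. w i * x i)" using assms(1) i by (intro member_le_sum) auto
    finally show "x i \<le> m" using x by (simp add: weighted_solutions_def)
  qed (simp add: weighted_solutions_def)
  show "finite {x. \<forall>i. (i \<in> I \<longrightarrow> x i \<in> {..m}) \<and> (i \<notin> I \<longrightarrow> x i = (0::nat))}"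
    using assms(1) by (intro finite_set_of_finite_funs) auto
qed

text \<open>Either \<open>x i\<close> is zero or it can be lowered by one, which lowers the total by
  \<open>w i\<close>. This is the coefficient form of multiplication by
  \<open>1 - X ^ w i\<close>.\<close>

lemma card_weighted_solutions_insert:
  assumes I: "finite I" "i \<notin> I" and w: "\<And>j. j \<in> insert i I \<Longrightarrow> 0 < w j"
  shows "card (weighted_solutions (insert i I) w m) = card (weighted_solutions I w m)
    + (if w i \<le> m then card (weighted_solutions (insert i I) w (m - w i)) else 0)"
proof -
  let ?W = "weighted_solutions"
  define inc where "inc x = x(i := Suc (x i))" for x :: "'a \<Rightarrow> nat"
  define R where "R = (if w i \<le> m then ?W (insert i I) w (m - w i) else {})"
  have sum_upd: "(\<Sum>j\<in>insert i I. w j * (x(i := k)) j) = w i * k + (\<Sum>j\<in>I. w j * x j)" for x k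
  proof -
    have "(\<Sum>j\<in>I. w j * (x(i := k)) j) = (\<Sum>j\<in>I. w j * x j)"
      using I by (intro sum.cong) auto
    then show ?thesis using I by simp
  qed
  have split: "?W (insert i I) w m = ?W I w m \<union> inc ` R"
  proof (intro equalityI subsetI)
    fix x assume x: "x \<in> ?W (insert i I) w m"
    show "x \<in> ?W I w m \<union> inc ` R"
    proof (cases "x i")
      case 0
      have "x j = 0" if "j \<notin> I" for j
        using x 0 that by (cases "j = i") (auto simp: weighted_solutions_def)
      then show ?thesis using x I 0 by (simp add: weighted_solutions_def)
    next
      case (Suc k)
      have "w i * Suc k + (\<Sum>j\<in>I. w j * x j) = m"
        using x sum_upd[of x "Suc k"] Suc by (auto simp: weighted_solutions_def fun_upd_idem)
      then have "w i \<le> m" "w i * k + (\<Sum>j\<in>I. w j * x j) = m - w i" by auto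
      then have "x(i := k) \<in> R"
        using x sum_upd[of x k] unfolding R_def weighted_solutions_def by simp
      moreover have "x = inc (x(i := k))" using Suc by (auto simp: inc_def)
      ultimately show ?thesis by blast
    qed
  next
    fix x assume "x \<in> ?W I w m \<union> inc ` R"
    then show "x \<in> ?W (insert i I) w m"
    proof
      assume "x \<in> ?W I w m"
      then show ?thesis using I by (auto simp: weighted_solutions_def)
    next
      assume "x \<in> inc ` R"
      then obtain y where y: "y \<in> R" "x = inc y" by blast
      then have "w i \<le> m" "y \<in> ?W (insert i I) w (m - w i)" by (auto simp: R_def split: if_splits)
      then have "w i * y i + (\<Sum>j\<in>I. w j * y j) = m - w i" "\<forall>j. j \<notin> insert i I \<longrightarrow> y j = 0"
        using I by (auto simp: weighted_solutions_def)
      then show ?thesis using \<open>w i \<le> m\<close> sum_upd[of y "Suc (y i)"]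
        unfolding weighted_solutions_def y(2) inc_def by simp
    qed
  qed
  have "inj_on inc R"
  proof (rule inj_onI)
    fix x y assume eq: "inc x = inc y"
    show "x = y"
    proof
      fix j show "x j = y j" using fun_cong[OF eq, of j] by (simp add: inc_def split: if_splits)
    qed
  qed
  moreover have "?W I w m \<inter> inc ` R = {}" using I by (auto simp: weighted_solutions_def inc_def)
  moreover have "finite (?W I w m)" "finite R"
    unfolding R_def using I w by (auto intro!: finite_weighted_solutions)
  ultimately have "card (?W (insert i I) w m) = card (?W I w m) + card R"
    unfolding split by (simp add: card_Un_disjoint card_image)
  then show ?thesis by (simp add: R_def)
qed

text \<open>Each index contributes a geometric series in \<open>X ^ w i\<close>. Stated as a product
  equal to 1, this needs no inverses of series.\<close>

lemma weighted_solutions_fps: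
  assumes "finite I" "\<And>i. i \<in> I \<Longrightarrow> 0 < w i"
  shows "Abs_fps (\<lambda>m. of_nat (card (weighted_solutions I w m)))
    * (\<Prod>i\<in>I. 1 - fps_X ^ w i) = (1 :: 'k::comm_ring_1 fps)"
  using assms
proof (induction I rule: finite_induct)
  case empty
  have "weighted_solutions ({} :: 'a set) w m = (if m = 0 then {\<lambda>_. 0} else {})" for m
    by (auto simp: weighted_solutions_def)
  then show ?case by (intro fps_ext) simp
next
  case (insert i I)
  let ?f = "\<lambda>I. Abs_fps (\<lambda>m. of_nat (card (weighted_solutions I w m))) :: 'k fps"
  have "?f (insert i I) * (1 - fps_X ^ w i) = ?f I"
  proof (rule fps_ext)
    fix m
    show "fps_nth (?f (insert i I) * (1 - fps_X ^ w i)) m = fps_nth (?f I) m"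
      using card_weighted_solutions_insert[OF insert.hyps, of w m] insert.prems
      by (simp add: right_diff_distrib fps_X_power_mult_right_nth)
  qed
  then show ?case using insert by (simp add: mult.assoc[symmetric])
qed

section \<open>Evaluation of q-binomials at complex numbers and roots of unity\<close>

definition eval_int_poly :: "complex \<Rightarrow> int poly \<Rightarrow> complex" where
  "eval_int_poly z p = poly (map_poly of_int p) z"

lemma eval_int_poly_add [simp]: "eval_int_poly z (p + q) = eval_int_poly z p + eval_int_poly z q"
proof -
  have "map_poly complex_of_int (p + q) = map_poly of_int p + map_poly of_int q"
    by (rule poly_eqI) (simp add: coeff_map_poly)
  then show ?thesis by (simp add: eval_int_poly_def)
qed

lemma eval_int_poly_mult [simp]: "eval_int_poly z (p * q) = eval_int_poly z p * eval_int_poly z q"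
proof -
  have "map_poly complex_of_int (p * q) = map_poly of_int p * map_poly of_int q"
    by (rule poly_eqI) (simp add: coeff_map_poly coeff_mult)
  then show ?thesis by (simp add: eval_int_poly_def)
qed

lemma eval_int_poly_monom [simp]: "eval_int_poly z (Polynomial.monom 1 k) = z ^ k"
  by (simp add: eval_int_poly_def map_poly_monom poly_monom)

lemma eval_int_poly_1 [simp]: "eval_int_poly z 1 = 1"
  by (simp add: eval_int_poly_def)

lemma eval_int_poly_q_int: "eval_int_poly z (q_int k) = (\<Sum>i<k. z ^ i)"
proof (induction k)
  case 0
  then show ?case by (simp add: eval_int_poly_def q_int_def)
next
  case (Suc k)
  have "q_int (Suc k) = q_int k + Polynomial.monom 1 k" by (simp add: q_int_def)
  then show ?case using Suc by simp
qed

lemma q_binomial_self: "q_binomial k k = 1"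
  using q_binomial_exact[of k k] q_fact_nonzero[of k] by (simp add: q_fact_def)

lemma q_binomial_0: "q_binomial k 0 = 1"
  using q_binomial_exact[of 0 k] q_fact_nonzero[of k] by (simp add: q_fact_def)

text \<open>The q-Pascal rule: after multiplication by the common factorials it becomes
  \<open>q_int_add\<close> for \<open>Suc n\<close> and \<open>Suc k\<close>.\<close>

lemma q_binomial_Suc_Suc:
  "q_binomial (Suc n + Suc k) (Suc k)
    = q_binomial (n + Suc k) (Suc k) + Polynomial.monom 1 (Suc n) * q_binomial (Suc n + k) k"
proof -
  let ?D = "q_fact (Suc k) * q_fact (Suc n)"
  have "q_binomial (Suc n + Suc k) (Suc k) * ?D = q_int (Suc n + Suc k) * q_fact (Suc (n + k))"
    using q_binomial_exact[of "Suc k" "Suc n + Suc k"] by (simp add: q_fact_Suc)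
  moreover have "q_binomial (n + Suc k) (Suc k) * ?D = q_int (Suc n) * q_fact (Suc (n + k))"
  proof -
    have "q_binomial (n + Suc k) (Suc k) * (q_fact (Suc k) * q_fact n) = q_fact (Suc (n + k))"
      using q_binomial_exact[of "Suc k" "n + Suc k"] by simp
    then show ?thesis unfolding q_fact_Suc[of n] by (metis mult.assoc mult.commute)
  qed
  moreover have "q_binomial (Suc n + k) k * ?D = q_int (Suc k) * q_fact (Suc (n + k))"
  proof -
    have "q_binomial (Suc n + k) k * (q_fact k * q_fact (Suc n)) = q_fact (Suc (n + k))"
      using q_binomial_exact[of k "Suc n + k"] by simp
    then show ?thesis unfolding q_fact_Suc[of k] by (metis mult.assoc mult.commute)
  qed
  ultimately have "q_binomial (Suc n + Suc k) (Suc k) * ?D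
      = (q_binomial (n + Suc k) (Suc k) + Polynomial.monom 1 (Suc n) * q_binomial (Suc n + k) k) * ?D"
    unfolding q_int_add[of "Suc n" "Suc k"] distrib_right by (metis mult.assoc)
  then show ?thesis by (simp add: q_fact_nonzero)
qed

text \<open>The q-binomial theorem for negative exponents. By the q-Pascal rule, multiplying the
  series for \<open>Suc n\<close> by its last factor yields the series for \<open>n\<close>.\<close>

lemma q_binomial_fps:
  "Abs_fps (\<lambda>m. eval_int_poly z (q_binomial (n + m) m))
    * (\<Prod>i<Suc n. 1 - fps_const (z ^ i) * fps_X) = 1"
proof (induction n)
  case 0
  show ?case by (rule fps_ext) (auto simp: right_diff_distrib q_binomial_self)
next
  case (Suc n)
  let ?f = "\<lambda>n. Abs_fps (\<lambda>m. eval_int_poly z (q_binomial (n + m) m))"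
  have "?f (Suc n) * (1 - fps_const (z ^ Suc n) * fps_X) = ?f n"
  proof (rule fps_ext)
    fix m
    have comm: "?f (Suc n) * (1 - fps_const (z ^ Suc n) * fps_X)
        = ?f (Suc n) - fps_const (z ^ Suc n) * (?f (Suc n) * fps_X)"
      by (simp add: algebra_simps)
    show "fps_nth (?f (Suc n) * (1 - fps_const (z ^ Suc n) * fps_X)) m = fps_nth (?f n) m"
      unfolding comm
      by (cases m) (simp_all add: q_binomial_0 q_binomial_Suc_Suc[simplified] del: power_Suc)
  qed
  moreover have "?f (Suc n) * (\<Prod>i<Suc (Suc n). 1 - fps_const (z ^ i) * fps_X)
      = (?f (Suc n) * (1 - fps_const (z ^ Suc n) * fps_X)) * (\<Prod>i<Suc n. 1 - fps_const (z ^ i) * fps_X)"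
    by (subst prod.lessThan_Suc) (simp only: mult_ac)
  ultimately show ?case by (simp only: Suc.IH)
qed

lemma primitive_root_of_unity_pow_inj:
  assumes "primitive_root_of_unity e z" "0 < e"
  shows "inj_on (\<lambda>i. z ^ i) {..<e}"
proof (rule linorder_inj_onI)
  fix i j assume ij: "i < j" "i \<in> {..<e}" "j \<in> {..<e}"
  have z0: "z \<noteq> 0" using assms by (auto simp: primitive_root_of_unity_def power_0_left)
  show "z ^ i \<noteq> z ^ j"
  proof
    assume "z ^ i = z ^ j"
    moreover have "z ^ j = z ^ i * z ^ (j - i)" using ij by (simp flip: power_add)
    ultimately have "z ^ (j - i) = 1" using z0 by simp
    then show False using assms ij by (auto simp: primitive_root_of_unity_def)
  qed
qed auto

text \<open>Two polynomials of degree at most \<open>e\<close> agree at \<open>Suc e\<close> points,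
  namely 0 and the powers of \<open>z\<close>; the identity is then transferred to power
  series.\<close>

lemma prod_one_minus_root_powers:
  assumes "primitive_root_of_unity e z" "0 < e"
  shows "(\<Prod>i<e. 1 - fps_const (z ^ i) * fps_X) = 1 - fps_X ^ e"
proof -
  define p where "p = (\<Prod>i<e. [:1, - (z ^ i):])"
  define q where "q = 1 - Polynomial.monom (1::complex) e"
  define A where "A = insert 0 ((\<lambda>i. z ^ i) ` {..<e})"
  have ze: "z ^ e = 1" using assms by (simp add: primitive_root_of_unity_def)
  then have z0: "z \<noteq> 0" using assms(2) by (auto simp: power_0_left)
  have A: "card A = Suc e"
    using z0 primitive_root_of_unity_pow_inj[OF assms] by (auto simp: A_def card_insert_if card_image)
  have "p = q"
  proof (rule poly_eqI_degree[of A])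
    fix x assume "x \<in> A"
    then consider "x = 0" | k where "k < e" "x = z ^ k" by (auto simp: A_def)
    then show "poly p x = poly q x"
    proof cases
      case 1
      then show ?thesis using assms(2) by (simp add: p_def q_def poly_prod poly_monom power_0_left)
    next
      case 2
      \<comment> \<open>\<open>z ^ i\<close> is the inverse of \<open>x\<close>. The reduction
        modulo \<open>e\<close> matters for \<open>k = 0\<close>, where \<open>e - k\<close> is out
        of range.\<close>
      define i where "i = (e - k) mod e"
      have "z ^ (i + k) = 1"
      proof (cases "k = 0")
        case False
        then show ?thesis using 2 ze by (simp add: i_def)
      qed (simp add: i_def)
      moreover have "i < e" using assms(2) by (simp add: i_def)
      ultimately have "poly p x = 0"
        unfolding p_def poly_prod using 2
        by (intro prod_zero) (auto intro!: bexI[of _ i] simp flip: power_add simp: add.commute)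
      moreover have "poly q x = 0"
        using 2 ze by (simp add: q_def poly_monom flip: power_mult) (simp add: mult.commute[of k] power_mult)
      ultimately show ?thesis by simp
    qed
  next
    have "degree [:1, c:] \<le> 1" for c :: complex by simp
    then have "degree p \<le> (\<Sum>i<e. 1)"
      unfolding p_def by (intro order.trans[OF degree_prod_sum_le] sum_mono) (auto simp only: comp_def finite_lessThan)
    then show "degree p < card A" using A by simp
    have "degree q \<le> e" unfolding q_def by (intro degree_diff_le) (simp_all add: degree_monom_le)
    then show "degree q < card A" using A by simp
  qed
  then have "fps_of_poly p = fps_of_poly q" by simp
  moreover have "fps_of_poly p = (\<Prod>i<e. 1 - fps_const (z ^ i) * fps_X)"
    unfolding p_def fps_of_poly_prod by (intro prod.cong refl) (simp add: fps_of_poly_linear')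
  moreover have "fps_of_poly q = 1 - fps_X ^ e"
    by (simp add: q_def fps_of_poly_diff fps_of_poly_monom')
  ultimately show ?thesis by simp
qed

lemma prod_one_minus_root_powers_mult:
  assumes "primitive_root_of_unity e z" "0 < e"
  shows "(\<Prod>i<e * A. 1 - fps_const (z ^ i) * fps_X) = (1 - fps_X ^ e) ^ A"
proof (induction A)
  case (Suc A)
  let ?g = "\<lambda>i. 1 - fps_const (z ^ i) * fps_X"
  have add: "(\<Prod>i<a + b. ?g i) = (\<Prod>i<a. ?g i) * (\<Prod>i<b. ?g (a + i))" for a b
    by (induction b) (simp_all add: mult.assoc)
  have "z ^ (e * A) = 1" using assms by (simp add: primitive_root_of_unity_def power_mult)
  then have "?g (e * A + i) = ?g i" for i by (simp add: power_add)
  then show ?case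
    using add[of "e * A" e] Suc prod_one_minus_root_powers[OF assms] by (simp add: add.commute)
qed simp

text \<open>
  Both sides have the generating function \<open>1 / ((1 - X) (1 - X ^ e) ^ A)\<close>.
\<close>

lemma eval_q_binomial_root_of_unity:
  assumes z: "primitive_root_of_unity e z" "0 < e"
    and Q: "finite Q" "q0 \<in> Q" "w q0 = 1" "\<And>q. q \<in> Q - {q0} \<Longrightarrow> w q = e"
    and A: "card Q = Suc A"
  shows "eval_int_poly z (q_binomial (e * A + m) m) = of_nat (card (weighted_solutions Q w m))"
proof -
  let ?f = "Abs_fps (\<lambda>m. eval_int_poly z (q_binomial (e * A + m) m))"
  let ?g = "Abs_fps (\<lambda>m. of_nat (card (weighted_solutions Q w m))) :: complex fps"
  let ?h = "(1 - fps_X ^ e) ^ A * (1 - fps_X) :: complex fps"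
  \<comment> \<open>The product in \<open>q_binomial_fps\<close> has \<open>e * A + 1\<close>
    factors; the last one becomes \<open>1 - X\<close>, the factor that belongs to
    \<open>q0\<close>.\<close>
  have "z ^ (e * A) = 1" using z by (simp add: primitive_root_of_unity_def power_mult)
  then have f: "?f * ?h = 1"
    using q_binomial_fps[of z "e * A"] prod_one_minus_root_powers_mult[OF z, of A]
    by (simp add: mult_ac)
  have "(\<Prod>q\<in>Q. 1 - fps_X ^ w q) = (1 - fps_X) * (\<Prod>q\<in>Q - {q0}. 1 - fps_X ^ e :: complex fps)"
    using Q by (subst prod.remove[of Q q0]) auto
  also have "\<dots> = ?h" using Q A by simp
  finally have "(\<Prod>q\<in>Q. 1 - fps_X ^ w q) = ?h" .
  moreover have "0 < w q" if "q \<in> Q" for q using Q z(2) that by (cases "q = q0") auto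
  ultimately have g: "?g * ?h = 1" using weighted_solutions_fps[OF Q(1), of w, where 'k = complex] by simp
  \<comment> \<open>\<open>?f\<close> and \<open>?g\<close> are both inverse to \<open>?h\<close>,
    hence equal.\<close>
  have "?f = ?f * (?g * ?h)" by (simp add: g)
  also have "\<dots> = ?g * (?f * ?h)" by (simp only: mult_ac)
  finally have "?f = ?g" by (simp add: f)
  then show ?thesis by (metis fps_nth_Abs_fps)
qed

text \<open>A function constant on classes is a function on the quotient; a class \<open>B\<close>
  adds its value once per element, hence the weight \<open>card B\<close>.\<close>

lemma card_class_constant_solutions:
  assumes r: "equiv S r" and fin: "finite S"
  shows "card {x \<in> weighted_solutions S (\<lambda>_. 1) m. \<forall>(g, h)\<in>r. x g = x h}
    = card (weighted_solutions (S // r) card m)"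
proof -
  define \<Phi> where "\<Phi> y g = (if g \<in> S then y (r `` {g}) else 0)" for y :: "'a set \<Rightarrow> nat" and g
  let ?X = "{x \<in> weighted_solutions S (\<lambda>_. 1) m. \<forall>(g, h)\<in>r. x g = x h}"
  let ?Y = "weighted_solutions (S // r) card m"
  have finq: "finite (S // r)" by (rule finite_quotient[OF fin equiv_type[OF r]])
  have cls: "{g \<in> S. r `` {g} = B} = B" if "B \<in> S // r" for B
  proof -
    obtain g0 where g0: "g0 \<in> S" "B = r `` {g0}" using \<open>B \<in> S // r\<close> by (rule quotientE)
    have "g \<in> S \<and> r `` {g} = B \<longleftrightarrow> g \<in> B" for g
      using eq_equiv_class_iff[OF r, of g0 g] g0 equiv_class_eq_iff[OF r, of g0 g] by auto
    then show ?thesis by auto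
  qed
  have sum: "(\<Sum>g\<in>S. \<Phi> y g) = (\<Sum>B\<in>S // r. card B * y B)" for y
  proof -
    have "(\<Sum>g\<in>S. \<Phi> y g) = (\<Sum>B\<in>S // r. \<Sum>g\<in>{g \<in> S. r `` {g} = B}. \<Phi> y g)"
      using fin finq by (intro sum.group[symmetric]) (auto intro: quotientI)
    also have "\<dots> = (\<Sum>B\<in>S // r. card B * y B)"
    proof (rule sum.cong[OF refl])
      fix B assume B: "B \<in> S // r"
      have "(\<Sum>g\<in>{g \<in> S. r `` {g} = B}. \<Phi> y g) = (\<Sum>g\<in>{g \<in> S. r `` {g} = B}. y B)"
        by (intro sum.cong) (auto simp: \<Phi>_def)
      then show "(\<Sum>g\<in>{g \<in> S. r `` {g} = B}. \<Phi> y g) = card B * y B" by (simp add: cls[OF B])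
    qed
    finally show ?thesis .
  qed
  have "bij_betw \<Phi> ?Y ?X"
  proof (rule bij_betw_imageI)
    show "inj_on \<Phi> ?Y"
    proof (rule inj_onI)
      fix y y' assume y: "y \<in> ?Y" "y' \<in> ?Y" and eq: "\<Phi> y = \<Phi> y'"
      show "y = y'"
      proof
        fix B
        show "y B = y' B"
        proof (cases "B \<in> S // r")
          case True
          then obtain g where "g \<in> S" "B = r `` {g}" by (rule quotientE)
          then show ?thesis using fun_cong[OF eq, of g] by (simp add: \<Phi>_def)
        next
          case False
          then show ?thesis using y by (simp add: weighted_solutions_def)
        qed
      qed
    qed
    show "\<Phi> ` ?Y = ?X"
    proof (intro equalityI subsetI)
      fix x assume "x \<in> \<Phi> ` ?Y"
      then obtain y where y: "y \<in> ?Y" "x = \<Phi> y" by blast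
      have "x g = x h" if "(g, h) \<in> r" for g h
        using equiv_class_eq[OF r that] equiv_class_eq_iff[OF r, of g h] that
        by (auto simp: y \<Phi>_def)
      then show "x \<in> ?X" using y sum[of y] by (auto simp: weighted_solutions_def \<Phi>_def)
    next
      fix x assume x: "x \<in> ?X"
      define y where "y B = (if B \<in> S // r then x (SOME g. g \<in> B) else 0)" for B
      have "\<Phi> y g = x g" for g
      proof (cases "g \<in> S")
        case True
        have "(SOME h. h \<in> r `` {g}) \<in> r `` {g}"
          by (rule someI[of _ g]) (use equiv_class_self[OF r True] in simp)
        then have "x (SOME h. h \<in> r `` {g}) = x g" using x by fastforce
        then show ?thesis using True quotientI[OF True, of r] by (simp add: \<Phi>_def y_def)
      next
        case False
        then show ?thesis using x by (simp add: \<Phi>_def weighted_solutions_def)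
      qed
      then have "\<Phi> y = x" by blast
      moreover have "y \<in> ?Y"
        using sum[of y] x \<open>\<Phi> y = x\<close> by (auto simp: weighted_solutions_def y_def)
      ultimately show "x \<in> \<Phi> ` ?Y" by blast
    qed
  qed
  then show ?thesis by (rule bij_betw_same_card[symmetric])
qed

lemma card_quotient_equal_classes:
  assumes "equiv S r" "finite S" "B0 \<in> S // r" "card B0 = 1" "\<And>B. B \<in> S // r - {B0} \<Longrightarrow> card B = e"
  shows "\<exists>A. card (S // r) = Suc A \<and> card S = Suc (e * A)"
proof -
  have fin: "finite (S // r)" by (rule finite_quotient[OF assms(2) equiv_type[OF assms(1)]])
  define A where "A = card (S // r - {B0})"
  have "card (\<Union>(S // r)) = (\<Sum>B\<in>S // r. card B)"
  proof (rule card_Union_disjoint)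
    show "pairwise disjnt (S // r)"
      using quotient_disj[OF assms(1)] unfolding pairwise_def disjnt_def by blast
    show "finite B" if "B \<in> S // r" for B
      using that by (rule finite_equiv_class[OF assms(2) equiv_type[OF assms(1)]])
  qed
  also have "\<dots> = 1 + e * A"
    using fin assms(3-5) by (subst sum.remove[of _ B0]) (auto simp: A_def)
  finally have "card S = Suc (e * A)" by (simp add: Union_quotient[OF assms(1)])
  moreover have "card (S // r) = Suc A" unfolding A_def using fin assms(3) by (rule card.remove)
  ultimately show ?thesis by blast
qed

text \<open>Apart from the singleton of \<open>p\<close>, every orbit of \<open>a\<close> has
  exactly \<open>e\<close> elements. So \<open>card S - 1\<close> is \<open>e\<close> times the
  number of the other orbits, and the invariant functions become the weighted solutions counted by
  \<open>eval_q_binomial_root_of_unity\<close>.\<close>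

lemma card_invariant_solutions:
  fixes a :: "'a \<Rightarrow> 'a"
  assumes fin: "finite S" and aS: "\<And>g. g \<in> S \<Longrightarrow> a g \<in> S" and p: "p \<in> S" "a p = p"
    and e: "0 < e"
    and per: "\<And>g. g \<in> S \<Longrightarrow> (a ^^ e) g = g"
    and free: "\<And>g i. g \<in> S \<Longrightarrow> g \<noteq> p \<Longrightarrow> 0 < i \<Longrightarrow> i < e \<Longrightarrow> (a ^^ i) g \<noteq> g"
    and z: "primitive_root_of_unity e z"
  shows "of_nat (card {x \<in> weighted_solutions S (\<lambda>_. 1) m. \<forall>g\<in>S. x (a g) = x g})
      = eval_int_poly z (q_binomial (card S - 1 + m) m)"
    and "\<exists>A. card S = Suc (e * A)"
proof -
  define r where "r = {(g, h). g \<in> S \<and> (\<exists>i. h = (a ^^ i) g)}"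
  have powS: "(a ^^ i) g \<in> S" if "g \<in> S" for g i
    by (induction i) (use that aS in auto)
  have per': "(a ^^ (e * k)) g = g" if "g \<in> S" for g k
    by (induction k) (use that per in \<open>auto simp: funpow_add\<close>)
  have mod: "(a ^^ i) g = (a ^^ (i mod e)) g" if "g \<in> S" for g i
  proof -
    have "(a ^^ (i mod e + e * (i div e))) g = (a ^^ (i mod e)) g"
      unfolding funpow_add using per'[OF that] by simp
    then show ?thesis by simp
  qed
  have equiv: "equiv S r"
  proof (rule equivI)
    show "r \<subseteq> S \<times> S" by (auto simp: r_def powS)
    show "refl_on S r" by (auto simp: r_def refl_on_def intro: exI[of _ 0])
    show "sym r"
    proof (rule symI)
      fix g h assume "(g, h) \<in> r"
      then obtain i where g: "g \<in> S" "h = (a ^^ i) g" by (auto simp: r_def)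
      \<comment> \<open>\<open>r\<close> uses forward iterates only. Symmetry comes from completing
        \<open>i\<close> steps to the multiple \<open>e * i\<close> of the period.\<close>
      have "i \<le> e * i" using e by simp
      then have "(a ^^ (e * i - i)) h = g" using per'[OF g(1), of i] 
        unfolding g(2) by (metis comp_apply funpow_add le_add_diff_inverse2)
      then have "\<exists>k. g = (a ^^ k) h" by metis
      then show "(h, g) \<in> r" using g powS by (simp add: r_def)
    qed
    show "trans r"
    proof (rule transI)
      fix g h k assume "(g, h) \<in> r" "(h, k) \<in> r"
      then show "(g, k) \<in> r" by (auto simp: r_def) (metis comp_apply funpow_add)
    qed
  qed
  have cls: "r `` {g} = (\<lambda>i. (a ^^ i) g) ` {..<e}" if "g \<in> S" for g
    using that e by (auto simp: r_def image_iff) (metis mod mod_less_divisor lessThan_iff)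
  have "(a ^^ i) p = p" for i by (induction i) (use p in auto)
  then have clsp: "r `` {p} = {p}" using e p by (auto simp: cls)
  have card_cls: "card B = e" if "B \<in> S // r - {{p}}" for B
  proof -
    obtain g where g: "g \<in> S" "B = r `` {g}" using \<open>B \<in> S // r - {{p}}\<close> by (auto elim: quotientE)
    then have gp: "g \<noteq> p" using that clsp by auto
    have "inj_on (\<lambda>i. (a ^^ i) g) {..<e}"
    proof (rule linorder_inj_onI)
      fix i j assume ij: "i < j" "i \<in> {..<e}" "j \<in> {..<e}"
      show "(a ^^ i) g \<noteq> (a ^^ j) g"
      proof
        assume "(a ^^ i) g = (a ^^ j) g"
        \<comment> \<open>Applying \<open>a\<close> another \<open>e - i\<close> times turns the
          collision into a return of \<open>g\<close> to itself after \<open>j - i\<close>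
          steps.\<close>
        then have "(a ^^ (e - i)) ((a ^^ i) g) = (a ^^ (e - i)) ((a ^^ j) g)" by simp
        moreover have "(a ^^ (e - i)) ((a ^^ i) g) = g"
          using ij per[OF g(1)] by (simp flip: comp_apply[of "a ^^ _" "a ^^ _"] funpow_add)
        moreover have "(a ^^ (e - i)) ((a ^^ j) g) = (a ^^ (j - i)) ((a ^^ e) g)"
          using ij by (simp add: add.commute flip: comp_apply[of "a ^^ _" "a ^^ _"] funpow_add)
        ultimately have "(a ^^ (j - i)) g = g" using per[OF g(1)] by simp
        then show False using free[OF g(1) gp, of "j - i"] ij by (simp add: less_imp_diff_less)
      qed
    qed auto
    then show ?thesis using g by (simp add: cls card_image)
  qed
  have pQ: "{p} \<in> S // r" using clsp p quotientI by metis
  obtain A where A: "card (S // r) = Suc A" "card S = Suc (e * A)"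
    using card_quotient_equal_classes[OF equiv fin pQ _ card_cls] by auto
  then show "\<exists>A. card S = Suc (e * A)" by blast
  have inv: "(\<forall>(g, h)\<in>r. x g = x h) \<longleftrightarrow> (\<forall>g\<in>S. x (a g) = x g)" for x :: "'a \<Rightarrow> nat"
  proof safe
    fix g assume "\<forall>(g, h)\<in>r. x g = x h" "g \<in> S"
    moreover have "(g, a g) \<in> r" using \<open>g \<in> S\<close> by (auto simp: r_def intro: exI[of _ 1])
    ultimately show "x (a g) = x g" by fastforce
  next
    fix g h assume inv: "\<forall>g\<in>S. x (a g) = x g" and "(g, h) \<in> r"
    then obtain i where g: "g \<in> S" "h = (a ^^ i) g" by (auto simp: r_def)
    have "x ((a ^^ i) g) = x g" by (induction i) (use g inv powS in auto)
    then show "x g = x h" using g by simp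
  qed
  have "finite (S // r)" by (rule finite_quotient[OF fin equiv_type[OF equiv]])
  then have "eval_int_poly z (q_binomial (e * A + m) m) = of_nat (card (weighted_solutions (S // r) card m))"
    using eval_q_binomial_root_of_unity[OF z e _ pQ, of card A m] card_cls A by auto
  then show "of_nat (card {x \<in> weighted_solutions S (\<lambda>_. 1) m. \<forall>g\<in>S. x (a g) = x g})
      = eval_int_poly z (q_binomial (card S - 1 + m) m)"
    using card_class_constant_solutions[OF equiv fin, of m] A unfolding inv by simp
qed


section \<open>Compositions with trivial product\<close>

lemma (in comm_group) hom_finprod:
  assumes "h \<in> hom G G" "f \<in> A \<rightarrow> carrier G"
  shows "h (finprod G f A) = finprod G (\<lambda>x. h (f x)) A"
  using assms(2)
proof (induction A rule: infinite_finite_induct)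
  case (insert x A)
  have h: "h y \<in> carrier G" if "y \<in> carrier G" for y using assms(1) that by (auto simp: hom_def)
  show ?case using insert h assms(1)
    by (simp add: Pi_def hom_def finprod_insert finprod_closed)
qed (use assms(1) hom_one[OF _ is_group is_group] in auto)

lemma (in comm_group) finprod_pow_sum:
  assumes "h \<in> carrier G" "finite A"
  shows "finprod G (\<lambda>g. h [^] (x g :: nat)) A = h [^] (\<Sum>g\<in>A. x g)"
  using assms(2) by induction (use assms(1) in \<open>auto simp: nat_pow_mult\<close>)

definition power_product :: "('a, 'b) monoid_scheme \<Rightarrow> ('a \<Rightarrow> nat) \<Rightarrow> 'a" where
  "power_product G x = (\<Otimes>\<^bsub>G\<^esub>g\<in>carrier G. g [^]\<^bsub>G\<^esub> x g)"

abbreviation compositions :: "('a, 'b) monoid_scheme \<Rightarrow> nat \<Rightarrow> ('a \<Rightarrow> nat) set" where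
  "compositions G m \<equiv> weighted_solutions (carrier G) (\<lambda>_. 1) m"

definition zero_sum_compositions :: "('a, 'b) monoid_scheme \<Rightarrow> nat \<Rightarrow> ('a \<Rightarrow> nat) set" where
  "zero_sum_compositions G m = {x \<in> compositions G m. power_product G x = \<one>\<^bsub>G\<^esub>}"

lemma (in comm_group) power_product_closed: "power_product G x \<in> carrier G"
  unfolding power_product_def by (intro finprod_closed) auto

lemma (in comm_group) power_product_reindex:
  assumes "bij_betw f (carrier G) (carrier G)"
  shows "power_product G x = (\<Otimes>g\<in>carrier G. f g [^] x (f g))"
proof -
  have "(\<Otimes>g\<in>f ` carrier G. g [^] x g) = (\<Otimes>g\<in>carrier G. f g [^] x (f g))"
    using assms by (intro finprod_reindex) (auto simp: bij_betw_def)
  then show ?thesis using assms by (simp add: bij_betw_def power_product_def)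
qed

text \<open>Reindexing along \<open>a\<close> lets \<open>a\<close> be pulled out of the product.
  With \<open>y = x\<close>, the product of an invariant composition is a fixed point of
  \<open>a\<close>; in general, automorphisms preserve the zero-sum condition.\<close>

lemma (in comm_group) power_product_equivariant:
  assumes a: "a \<in> hom G G" "bij_betw a (carrier G) (carrier G)"
    and y: "\<And>g. g \<in> carrier G \<Longrightarrow> y (a g) = x g"
  shows "power_product G y = a (power_product G x)"
proof -
  have ac: "a g \<in> carrier G" if "g \<in> carrier G" for g using a that by (auto simp: hom_def)
  have "power_product G y = (\<Otimes>g\<in>carrier G. a g [^] y (a g))"
    by (rule power_product_reindex[OF a(2)])
  also have "\<dots> = (\<Otimes>g\<in>carrier G. a (g [^] x g))"
    using ac y a(1) by (intro finprod_cong') (auto simp: hom_nat_pow is_group)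
  also have "\<dots> = a (power_product G x)"
    unfolding power_product_def by (subst hom_finprod[OF a(1)]) auto
  finally show ?thesis .
qed

text \<open>If \<open>u\<close> inverts \<open>m\<close> modulo the group order, then
  \<open>t [^] u\<close> is an \<open>m\<close>-th root of \<open>t\<close>.\<close>

lemma (in comm_group) coprime_pow_surj:
  assumes "finite (carrier G)" "coprime (order G) m" "t \<in> carrier G"
  obtains h where "h \<in> carrier G" "h [^] m = t"
proof -
  obtain u where u: "[m * u = 1] (mod order G)"
    using assms(2) cong_solve_coprime_nat[of m "order G"] by (auto simp: coprime_commute)
  have "[int (m * u) = 1] (mod int (ord t))"
    using cong_dvd_modulus_nat[OF u ord_dvd_group_order[OF assms(3)]] by (metis cong_int_iff of_nat_1)
  then have "t [^] int (m * u) = t [^] (1::int)"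
    using int_pow_eq[OF assms(3)] by (simp add: cong_iff_dvd_diff dvd_diff_commute)
  then have "t [^] (m * u) = t" using assms(3) by (simp add: int_pow_int del: of_nat_mult)
  then have "(t [^] u) [^] m = t" using assms(3) by (simp add: nat_pow_pow mult.commute)
  then show ?thesis using that[of "t [^] u"] assms(3) by simp
qed

section \<open>Translations and equidistribution of the products\<close>

definition translate :: "('a, 'b) monoid_scheme \<Rightarrow> 'a \<Rightarrow> ('a \<Rightarrow> nat) \<Rightarrow> 'a \<Rightarrow> nat" where
  "translate G h x = (\<lambda>g. if g \<in> carrier G then x (g \<otimes>\<^bsub>G\<^esub> inv\<^bsub>G\<^esub> h) else 0)"

lemma (in comm_group) bij_betw_mult_right:
  assumes "h \<in> carrier G"
  shows "bij_betw (\<lambda>g. g \<otimes> h) (carrier G) (carrier G)"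
  by (rule bij_betw_byWitness[of _ "\<lambda>g. g \<otimes> inv h"]) (use assms in \<open>auto simp: m_assoc\<close>)

lemma (in comm_group) translate_in_compositions:
  assumes "x \<in> compositions G m" "h \<in> carrier G"
  shows "translate G h x \<in> compositions G m"
proof -
  have "(\<Sum>g\<in>carrier G. translate G h x g) = (\<Sum>g\<in>carrier G. x (g \<otimes> inv h))"
    by (rule sum.cong) (simp_all add: translate_def)
  also have "\<dots> = (\<Sum>g\<in>carrier G. x g)"
    using sum.reindex_bij_betw[OF bij_betw_mult_right[of "inv h"], of x] assms(2) by simp
  finally show ?thesis using assms(1) by (auto simp: weighted_solutions_def translate_def)
qed

lemma (in comm_group) power_product_translate:
  assumes "finite (carrier G)" "x \<in> compositions G m" "h \<in> carrier G"
  shows "power_product G (translate G h x) = power_product G x \<otimes> h [^] m"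
proof -
  have "power_product G (translate G h x) = (\<Otimes>g\<in>carrier G. (g \<otimes> h) [^] translate G h x (g \<otimes> h))"
    by (rule power_product_reindex[OF bij_betw_mult_right[OF assms(3)]])
  also have "\<dots> = (\<Otimes>g\<in>carrier G. g [^] x g \<otimes> h [^] x g)"
    using assms(3) by (intro finprod_cong') (auto simp: translate_def m_assoc nat_pow_distrib)
  also have "\<dots> = power_product G x \<otimes> (\<Otimes>g\<in>carrier G. h [^] x g)"
    unfolding power_product_def using assms(3) by (intro finprod_multf) auto
  also have "(\<Otimes>g\<in>carrier G. h [^] x g) = h [^] m"
    using assms by (simp add: finprod_pow_sum weighted_solutions_def)
  finally show ?thesis .
qed

lemma (in comm_group) translate_translate_inv:
  assumes "x \<in> compositions G m" "h \<in> carrier G"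
  shows "translate G h (translate G (inv h) x) = x" "translate G (inv h) (translate G h x) = x"
  using assms by (auto simp: translate_def weighted_solutions_def m_assoc)

text \<open>Translation by \<open>h\<close> multiplies the product by \<open>h [^] m\<close>, and by
  coprimality every group element is such a power. So all fibres of \<open>power_product\<close>
  over the carrier have equal size.\<close>

lemma (in comm_group) card_zero_sum_compositions:
  assumes fin: "finite (carrier G)" and cop: "coprime (order G) m"
  shows "order G * card (zero_sum_compositions G m) = card (compositions G m)"
proof -
  define F where "F t = {x \<in> compositions G m. power_product G x = t}" for t
  have finF: "finite (compositions G m)" by (rule finite_weighted_solutions) (use fin in auto)
  have card_F: "card (F t) = card (F \<one>)" if t: "t \<in> carrier G" for t
  proof -
    obtain h where h: "h \<in> carrier G" "h [^] m = t" using coprime_pow_surj[OF fin cop t] .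
    have "bij_betw (translate G h) (F \<one>) (F t)"
      by (rule bij_betw_byWitness[of _ "translate G (inv h)"])
        (use h in \<open>auto simp: F_def translate_translate_inv translate_in_compositions
          power_product_translate[OF fin] nat_pow_inv simp del: One_nat_def\<close>)
    then show ?thesis by (metis bij_betw_same_card)
  qed
  have "card (compositions G m) = (\<Sum>t\<in>carrier G. card (F t))"
  proof -
    have "compositions G m = (\<Union>t\<in>carrier G. F t)" by (auto simp: F_def power_product_closed)
    then have "card (compositions G m) = card (\<Union>t\<in>carrier G. F t)" by simp
    also have "\<dots> = (\<Sum>t\<in>carrier G. card (F t))"
      using finF fin by (intro card_UN_disjoint) (auto simp: F_def)
    finally show ?thesis .
  qed
  also have "\<dots> = (\<Sum>t\<in>carrier G. card (F \<one>))" by (rule sum.cong[OF refl card_F])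
  finally show ?thesis by (simp add: order_def F_def zero_sum_compositions_def)
qed

text \<open>The right-hand side is the q-binomial that counts all invariant compositions, whatever
  their product; the factor \<open>q_int n\<close> measures the share with trivial product.\<close>

lemma q_int_mult_q_Catalan:
  assumes "coprime n m" "0 < m" "0 < n"
  shows "q_int n * q_Catalan n m = q_binomial (n - 1 + m) m"
proof -
  obtain k where n: "n = Suc k" using assms(3) gr0_implies_Suc by blast
  have "q_int n * q_Catalan n m * (q_fact m * q_fact k) = q_fact (k + m)"
    using q_Catalan_q_fact[OF assms(1,2)] by (simp add: n q_fact_Suc mult_ac)
  then have "q_int n * q_Catalan n m * (q_fact m * q_fact k) = q_binomial (k + m) m * (q_fact m * q_fact k)"
    using q_binomial_exact[of m "k + m"] by simp
  then show ?thesis by (simp add: n q_fact_nonzero)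
qed

text \<open>
  For \<open>e > 1\<close> the product of an invariant composition is fixed by \<open>a\<close>, hence equal to \<open>\<one>\<close>;
  since \<open>n\<close> is congruent to \<open>1\<close> modulo \<open>e\<close>, also \<open>[n]\<^sub>q = 1\<close> at \<open>q = z\<close>.
  For \<open>e = 1\<close> the factor \<open>[n]\<^sub>q = n\<close> accounts for the equidistribution of the products.
\<close>

lemma (in comm_group) card_invariant_zero_sum_compositions:
  assumes fin: "finite (carrier G)" and cop: "coprime (order G) m" and m: "0 < m"
    and a: "a \<in> hom G G" "bij_betw a (carrier G) (carrier G)"
    and e: "0 < e"
    and per: "\<And>g. g \<in> carrier G \<Longrightarrow> (a ^^ e) g = g"
    and free: "\<And>g i. g \<in> carrier G \<Longrightarrow> g \<noteq> \<one> \<Longrightarrow> 0 < i \<Longrightarrow> i < e \<Longrightarrow> (a ^^ i) g \<noteq> g"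
    and z: "primitive_root_of_unity e z"
  shows "of_nat (card {x \<in> zero_sum_compositions G m. \<forall>g\<in>carrier G. x (a g) = x g})
      = eval_int_poly z (q_Catalan (order G) m)"
proof -
  let ?n = "order G" and ?inv = "\<lambda>x. \<forall>g\<in>carrier G. x (a g) = x g"
  have n: "0 < ?n" using fin by (simp add: order_gt_0_iff_finite)
  have ac: "a g \<in> carrier G" if "g \<in> carrier G" for g using a that by (auto simp: hom_def)
  have a1: "a \<one> = \<one>" using hom_one[OF a(1) is_group is_group] .
  have "of_nat (card {x \<in> compositions G m. ?inv x})
      = eval_int_poly z (q_binomial (card (carrier G) - 1 + m) m)"
    by (rule card_invariant_solutions(1)) (fact fin ac one_closed a1 e per free z)+
  then have count: "of_nat (card {x \<in> compositions G m. ?inv x})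
      = eval_int_poly z (q_int ?n) * eval_int_poly z (q_Catalan ?n m)"
    by (simp only: order_def[symmetric] eval_int_poly_mult[symmetric] q_int_mult_q_Catalan[OF cop m n])
  have "\<exists>A. card (carrier G) = Suc (e * A)"
    by (rule card_invariant_solutions(2)) (fact fin ac one_closed a1 e per free z)+
  then obtain A where A: "?n = Suc (e * A)" by (auto simp: order_def)
  show ?thesis
  proof (cases "e = 1")
    case True
    then have inv: "?inv x" for x :: "'a \<Rightarrow> nat" using per by simp
    have "z = 1" using z True by (simp add: primitive_root_of_unity_def)
    then have "eval_int_poly z (q_int ?n) = of_nat ?n" by (simp add: eval_int_poly_q_int)
    moreover have "card {x \<in> compositions G m. ?inv x} = ?n * card (zero_sum_compositions G m)"
      using card_zero_sum_compositions[OF fin cop] inv by simp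
    ultimately show ?thesis using count n inv by simp
  next
    case False
    then have e1: "1 < e" using e by simp
    have "power_product G x = \<one>" if "?inv x" for x
    proof (rule ccontr)
      assume "power_product G x \<noteq> \<one>"
      moreover have "a (power_product G x) = power_product G x"
        using power_product_equivariant[OF a, of x x] that by simp
      ultimately show False using free[OF power_product_closed, of x 1] e1 by simp
    qed
    then have "{x \<in> zero_sum_compositions G m. ?inv x} = {x \<in> compositions G m. ?inv x}"
      by (auto simp: zero_sum_compositions_def)
    moreover have "eval_int_poly z (q_int ?n) = 1"
    proof -
      have z1: "z \<noteq> 1" "z ^ e = 1" using z e1 by (auto simp: primitive_root_of_unity_def dest: spec[of _ 1])
      then have "z ^ ?n = z" by (simp add: A power_mult)
      then show ?thesis using z1 by (simp add: eval_int_poly_q_int geometric_sum)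
    qed
    ultimately show ?thesis using count by simp
  qed
qed


section \<open>The action on the lattice points\<close>

lemma carrier_AutoGroup: "carrier (AutoGroup G) = auto G"
  by (simp add: AutoGroup_def)

lemma AutoGroup_mult:
  assumes "a \<in> carrier (AutoGroup G)" "b \<in> carrier (AutoGroup G)"
  shows "a \<otimes>\<^bsub>AutoGroup G\<^esub> b = compose (carrier G) a b"
  using assms by (simp add: AutoGroup_def BijGroup_def auto_def)

lemma AutoGroup_one: "\<one>\<^bsub>AutoGroup G\<^esub> = (\<lambda>g\<in>carrier G. g)"
  by (simp add: AutoGroup_def BijGroup_def)

lemma AutoGroupD:
  assumes "a \<in> carrier (AutoGroup G)"
  shows "a \<in> hom G G" "bij_betw a (carrier G) (carrier G)" "a \<in> extensional (carrier G)"
  using assms by (auto simp: carrier_AutoGroup auto_def Bij_def)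

lemma finite_carrier_AutoGroup:
  assumes "finite (carrier G)"
  shows "finite (carrier (AutoGroup G))"
proof (rule finite_subset)
  show "carrier (AutoGroup G) \<subseteq> carrier G \<rightarrow>\<^sub>E carrier G"
    using AutoGroupD(2,3)[of _ G] by (auto simp: PiE_def dest: bij_betw_imp_funcset)
  show "finite (carrier G \<rightarrow>\<^sub>E carrier G)" using assms by (simp add: finite_PiE)
qed

text \<open>Elements of \<open>AutoGroup G\<close> are extensional, so their powers are compared
  with the iterates \<open>a ^^ k\<close> on the carrier only.\<close>

lemma (in group) AutoGroup_pow_apply:
  assumes "a \<in> carrier (AutoGroup G)" "g \<in> carrier G"
  shows "(a [^]\<^bsub>AutoGroup G\<^esub> (k::nat)) g = (a ^^ k) g"
proof -
  interpret A: group "AutoGroup G" by (rule AutoGroup)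
  have mem: "(a ^^ i) g \<in> carrier G" if "g \<in> carrier G" for i g
    by (induction i) (use that bij_betwE[OF AutoGroupD(2)[OF assms(1)]] in auto)
  have "a g \<in> carrier G" using mem[OF assms(2), of 1] by simp
  then show ?thesis using assms(2)
  proof (induction k arbitrary: g)
    case 0
    then show ?case by (simp add: AutoGroup_one)
  next
    case (Suc k)
    have "a (a g) \<in> carrier G" using mem[OF Suc.prems(2), of 2] by (simp add: numeral_2_eq_2)
    then show ?case using Suc assms(1)
      by (simp add: AutoGroup_mult compose_eq funpow_swap1)
  qed
qed

lemma aut_act_in_coord_space: "aut_act G a x \<in> coord_space G"
  by (simp add: aut_act_def coord_space_def)

lemma aut_act_one: "x \<in> coord_space G \<Longrightarrow> aut_act G (\<lambda>g\<in>carrier G. g) x = x"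
proof -
  assume x: "x \<in> coord_space G"
  have "inv_into (carrier G) (\<lambda>g\<in>carrier G. g) g = g" if "g \<in> carrier G" for g
    using inv_into_f_f[of "\<lambda>g\<in>carrier G. g" "carrier G" g] that by (simp add: inj_on_def)
  then show ?thesis using x by (auto simp: aut_act_def coord_space_def)
qed

lemma aut_act_compose:
  assumes a: "a \<in> carrier (AutoGroup G)" and b: "b \<in> carrier (AutoGroup G)"
  shows "aut_act G (compose (carrier G) a b) x = aut_act G a (aut_act G b x)"
proof
  fix g
  note bij = AutoGroupD(2)[OF a] AutoGroupD(2)[OF b]
  show "aut_act G (compose (carrier G) a b) x g = aut_act G a (aut_act G b x) g"
  proof (cases "g \<in> carrier G")
    case True
    let ?h = "inv_into (carrier G) b (inv_into (carrier G) a g)"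
    have mem: "inv_into (carrier G) a g \<in> carrier G" "?h \<in> carrier G"
      using True bij by (auto intro!: bij_betwE[OF bij_betw_inv_into, rule_format])
    have "compose (carrier G) a b ?h = g"
      using mem True bij by (simp add: compose_eq bij_betw_inv_into_right)
    moreover have "inj_on (compose (carrier G) a b) (carrier G)"
      using bij_betw_compose[OF bij(2,1)] by (simp add: bij_betw_def)
    ultimately have "inv_into (carrier G) (compose (carrier G) a b) g = ?h"
      using inv_into_f_f mem(2) by metis
    then show ?thesis using True mem by (simp add: aut_act_def)
  qed (simp add: aut_act_def)
qed

section \<open>The faithful representation of automorphisms by \<open>aut_tilde\<close>\<close>

lemma BijGroup_UNIV:
  "carrier (BijGroup UNIV) = {f. bij f}" "\<one>\<^bsub>BijGroup UNIV\<^esub> = id"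
  by (auto simp: BijGroup_def Bij_def id_def)

lemma BijGroup_UNIV_mult: "bij f \<Longrightarrow> bij g \<Longrightarrow> f \<otimes>\<^bsub>BijGroup UNIV\<^esub> g = f \<circ> g"
  by (auto simp: BijGroup_def Bij_def compose_def)

context
  fixes G :: "('a, 'b) monoid_scheme" and T :: "('a \<Rightarrow> real) \<Rightarrow> real ^ 'n"
  assumes G: "group G" and T: "linear_iso_on_coord_space G T"
begin

interpretation group G by (rule G)
interpretation A: group "AutoGroup G" by (rule AutoGroup)

lemma T_inv_into: "x \<in> coord_space G \<Longrightarrow> inv_into (coord_space G) T (T x) = x"
  using T by (simp add: linear_iso_on_coord_space_def bij_betw_def)

lemma T_eq_iff: "x \<in> coord_space G \<Longrightarrow> y \<in> coord_space G \<Longrightarrow> T x = T y \<longleftrightarrow> x = y"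
  using T by (auto simp: linear_iso_on_coord_space_def bij_betw_def inj_on_eq_iff)

lemma T_surj: obtains x where "x \<in> coord_space G" "v = T x"
  using T by (auto simp: linear_iso_on_coord_space_def bij_betw_def) (metis UNIV_I image_iff)

lemma T_scale: "x \<in> coord_space G \<Longrightarrow> T (\<lambda>g. s * x g) = s *\<^sub>R T x"
  using T by (simp add: linear_iso_on_coord_space_def)

lemma aut_tilde_T: "x \<in> coord_space G \<Longrightarrow> aut_tilde G T a (T x) = T (aut_act G a x)"
  by (simp add: aut_tilde_def T_inv_into)

lemma aut_tilde_mult:
  assumes "a \<in> carrier (AutoGroup G)" "b \<in> carrier (AutoGroup G)"
  shows "aut_tilde G T (a \<otimes>\<^bsub>AutoGroup G\<^esub> b) = aut_tilde G T a \<circ> aut_tilde G T b"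
proof
  fix v
  obtain x where "x \<in> coord_space G" "v = T x" by (rule T_surj)
  then show "aut_tilde G T (a \<otimes>\<^bsub>AutoGroup G\<^esub> b) v = (aut_tilde G T a \<circ> aut_tilde G T b) v"
    using assms by (simp add: AutoGroup_mult aut_tilde_T aut_act_compose aut_act_in_coord_space)
qed

lemma aut_tilde_one: "aut_tilde G T \<one>\<^bsub>AutoGroup G\<^esub> = id"
proof
  fix v
  obtain x where "x \<in> coord_space G" "v = T x" by (rule T_surj)
  then show "aut_tilde G T \<one>\<^bsub>AutoGroup G\<^esub> v = id v"
    by (simp add: AutoGroup_one aut_tilde_T aut_act_one)
qed

lemma bij_aut_tilde:
  assumes "a \<in> carrier (AutoGroup G)"
  shows "bij (aut_tilde G T a)"
proof (rule o_bij)
  let ?b = "inv\<^bsub>AutoGroup G\<^esub> a"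
  show "aut_tilde G T ?b \<circ> aut_tilde G T a = id"
    using assms by (simp flip: aut_tilde_mult add: aut_tilde_one)
  show "aut_tilde G T a \<circ> aut_tilde G T ?b = id"
    using assms by (simp flip: aut_tilde_mult add: aut_tilde_one)
qed

lemma aut_tilde_group_hom: "group_hom (AutoGroup G) (BijGroup UNIV) (aut_tilde G T)"
proof (intro group_hom.intro group_hom_axioms.intro)
  show "aut_tilde G T \<in> hom (AutoGroup G) (BijGroup UNIV)"
    by (auto simp: hom_def BijGroup_UNIV bij_aut_tilde BijGroup_UNIV_mult aut_tilde_mult)
qed (simp_all add: A.is_group group_BijGroup)

text \<open>The action sends the coordinate vector of \<open>g\<close> to that of
  \<open>a g\<close>, so an automorphism that acts trivially fixes every element.\<close>

lemma aut_tilde_eq_id_iff: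
  assumes "a \<in> carrier (AutoGroup G)"
  shows "aut_tilde G T a = id \<longleftrightarrow> a = \<one>\<^bsub>AutoGroup G\<^esub>"
proof
  assume id: "aut_tilde G T a = id"
  note bij = AutoGroupD(2)[OF assms]
  have "a g = g" if g: "g \<in> carrier G" for g
  proof (rule ccontr)
    assume ne: "a g \<noteq> g"
    define x where "x h = (if h = g then 1 else 0 :: real)" for h
    have x: "x \<in> coord_space G" using g by (auto simp: x_def coord_space_def)
    then have "aut_act G a x = x"
      using fun_cong[OF id, of "T x"] by (simp add: aut_tilde_T T_eq_iff aut_act_in_coord_space)
    then have "aut_act G a x (a g) = x (a g)" by simp
    then show False using ne g bij bij_betwE[OF bij]
      by (simp add: aut_act_def x_def bij_betw_inv_into_left)
  qed
  then show "a = \<one>\<^bsub>AutoGroup G\<^esub>"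
    using AutoGroupD(3)[OF assms] by (auto simp: AutoGroup_one extensional_def)
qed (simp add: aut_tilde_one)

text \<open>Faithfulness preserves orders, so in the theorem the group generated by
  \<open>aut_tilde G T c\<close> has order \<open>d\<close>.\<close>

lemma ord_aut_tilde:
  assumes "a \<in> carrier (AutoGroup G)"
  shows "group.ord (BijGroup UNIV) (aut_tilde G T a) = A.ord a"
proof -
  interpret h: group_hom "AutoGroup G" "BijGroup UNIV" "aut_tilde G T" by (rule aut_tilde_group_hom)
  have "aut_tilde G T a [^]\<^bsub>BijGroup UNIV\<^esub> k = \<one>\<^bsub>BijGroup UNIV\<^esub> \<longleftrightarrow> A.ord a dvd k" for k :: nat
  proof -
    have "aut_tilde G T a [^]\<^bsub>BijGroup UNIV\<^esub> k = aut_tilde G T (a [^]\<^bsub>AutoGroup G\<^esub> k)"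
      using assms by (simp add: h.hom_nat_pow)
    then show ?thesis using assms by (simp add: BijGroup_UNIV aut_tilde_eq_id_iff A.pow_eq_id)
  qed
  then show ?thesis using assms by (simp add: h.H.ord_unique)
qed

end

section \<open>Lattice points of the dilate as zero-sum compositions\<close>

lemma real_compositions_in_coord_space:
  "x \<in> compositions G m \<Longrightarrow> (\<lambda>g. real (x g)) \<in> coord_space G"
  by (simp add: weighted_solutions_def coord_space_def)

text \<open>Pulled back along \<open>T\<close>, a point of the dilate is a nonnegative vector of
  total \<open>m\<close>, and integrality means membership in the zero-sum lattice. The converse
  divides a composition by \<open>m\<close>.\<close>

lemma (in comm_group) dilate_lattice_points_eq:
  fixes T :: "('a \<Rightarrow> real) \<Rightarrow> real ^ 'n"
  assumes T: "linear_iso_on_coord_space G T" "T ` zero_sum_lattice G = int_vectors" and m: "0 < m"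
  shows "dilate_lattice_points m (zero_sum_polytope G T)
    = (\<lambda>x. T (\<lambda>g. real (x g))) ` zero_sum_compositions G m"
proof (intro equalityI subsetI)
  fix v assume v: "v \<in> dilate_lattice_points m (zero_sum_polytope G T)"
  then obtain y where y: "y \<in> group_simplex G" "v = real m *\<^sub>R T y"
    by (auto simp: dilate_lattice_points_def zero_sum_polytope_def)
  have "v \<in> int_vectors" using v by (simp add: dilate_lattice_points_def)
  then obtain l where l: "l \<in> zero_sum_lattice G" "v = T l" using T(2) by blast
  have yc: "y \<in> coord_space G" using y(1) by (simp add: group_simplex_def)
  have lc: "l \<in> coord_space G" using l(1) by (simp add: zero_sum_lattice_def)
  have "(\<lambda>g. real m * y g) \<in> coord_space G" using yc by (simp add: coord_space_def)
  moreover have "T l = T (\<lambda>g. real m * y g)"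
    using T_scale[OF is_group T(1) yc, of "real m"] l(2) y(2) by simp
  ultimately have ly: "l = (\<lambda>g. real m * y g)" using T_eq_iff[OF is_group T(1) lc] by blast
  obtain a where a: "\<And>g. g \<in> carrier G \<Longrightarrow> l g = of_int (a g)"
      "(\<Otimes>g\<in>carrier G. g [^] a g) = \<one>"
    using l(1) unfolding zero_sum_lattice_def by blast
  \<comment> \<open>\<open>nat\<close> loses nothing, since the coordinates of \<open>l\<close> are
    nonnegative; \<open>compositions\<close> demands the value 0 off the carrier.\<close>
  define x where "x g = (if g \<in> carrier G then nat (a g) else 0)" for g
  have xa: "int (x g) = a g" if "g \<in> carrier G" for g
  proof -
    have "0 \<le> l g" using y(1) that by (simp add: ly group_simplex_def)
    then show ?thesis using a(1)[OF that] that by (simp add: x_def)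
  qed
  have "l g = real (x g)" for g
  proof (cases "g \<in> carrier G")
    case True
    then show ?thesis using a(1)[OF True] xa[OF True] by (metis of_int_of_nat_eq)
  next
    case False
    then show ?thesis using lc by (simp add: x_def coord_space_def)
  qed
  then have lx: "l = (\<lambda>g. real (x g))" by blast
  have "real (\<Sum>g\<in>carrier G. x g) = (\<Sum>g\<in>carrier G. l g)" by (simp add: lx)
  also have "\<dots> = real m * (\<Sum>g\<in>carrier G. y g)" by (simp add: ly sum_distrib_left)
  also have "\<dots> = real m" using y(1) by (simp add: group_simplex_def)
  finally have "(\<Sum>g\<in>carrier G. x g) = m" by linarith
  then have "x \<in> compositions G m" by (simp add: weighted_solutions_def x_def)
  moreover have "power_product G x = \<one>"
  proof -
    have "power_product G x = (\<Otimes>g\<in>carrier G. g [^] a g)"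
      unfolding power_product_def by (intro finprod_cong') (auto simp flip: int_pow_int simp: xa)
    then show ?thesis using a(2) by simp
  qed
  ultimately show "v \<in> (\<lambda>x. T (\<lambda>g. real (x g))) ` zero_sum_compositions G m"
    using l(2) lx by (auto simp: zero_sum_compositions_def)
next
  fix v assume "v \<in> (\<lambda>x. T (\<lambda>g. real (x g))) ` zero_sum_compositions G m"
  then obtain x where x: "x \<in> compositions G m" "power_product G x = \<one>" "v = T (\<lambda>g. real (x g))"
    by (auto simp: zero_sum_compositions_def)
  have c: "(\<lambda>g. real (x g)) \<in> coord_space G" by (rule real_compositions_in_coord_space[OF x(1)])
  define y where "y g = real (x g) / real m" for g
  have yc: "y \<in> coord_space G" using c by (simp add: coord_space_def y_def)
  have "(\<Sum>g\<in>carrier G. y g) = real (\<Sum>g\<in>carrier G. x g) / real m"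
    by (simp add: y_def sum_divide_distrib)
  then have "(\<Sum>g\<in>carrier G. y g) = 1" using x(1) m by (simp add: weighted_solutions_def del: of_nat_sum)
  then have "y \<in> group_simplex G" using yc by (simp add: group_simplex_def y_def)
  moreover have "v = real m *\<^sub>R T y"
    using T_scale[OF is_group T(1) yc, of "real m"] m by (simp add: y_def x(3))
  moreover have "(\<lambda>g. real (x g)) \<in> zero_sum_lattice G"
    using c x(2) unfolding zero_sum_lattice_def power_product_def
    by (auto intro!: exI[of _ "\<lambda>g. int (x g)"] simp: int_pow_int)
  then have "v \<in> int_vectors" using T(2) x(3) by blast
  ultimately show "v \<in> dilate_lattice_points m (zero_sum_polytope G T)"
    unfolding dilate_lattice_points_def zero_sum_polytope_def by blast
qed

lemma inj_on_T_real:
  fixes T :: "('a \<Rightarrow> real) \<Rightarrow> real ^ 'n"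
  assumes "group G" "linear_iso_on_coord_space G T"
  shows "inj_on (\<lambda>x. T (\<lambda>g. real (x g))) (zero_sum_compositions G m)"
proof (rule inj_onI)
  fix x y assume "x \<in> zero_sum_compositions G m" "y \<in> zero_sum_compositions G m"
    and eq: "T (\<lambda>g. real (x g)) = T (\<lambda>g. real (y g))"
  then have "(\<lambda>g. real (x g)) = (\<lambda>g. real (y g))"
    using T_eq_iff[OF assms] real_compositions_in_coord_space[of _ G m]
    by (auto simp: zero_sum_compositions_def)
  then show "x = y" by (metis of_nat_eq_iff ext)
qed

lemma (in comm_group) aut_act_zero_sum_compositions:
  assumes x: "x \<in> zero_sum_compositions G m" and a: "a \<in> carrier (AutoGroup G)"
  obtains y where "y \<in> zero_sum_compositions G m" "aut_act G a (\<lambda>g. real (x g)) = (\<lambda>g. real (y g))"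
proof
  note bij = AutoGroupD(2)[OF a]
  define y where "y g = (if g \<in> carrier G then x (inv_into (carrier G) a g) else 0)" for g
  have ya: "y (a g) = x g" if "g \<in> carrier G" for g
    using that bij_betwE[OF bij] bij by (simp add: y_def bij_betw_inv_into_left)
  have "(\<Sum>g\<in>carrier G. y g) = (\<Sum>g\<in>carrier G. x g)"
    by (subst sum.reindex_bij_betw[OF bij, symmetric]) (simp add: ya)
  moreover have "power_product G y = \<one>"
  proof -
    have "power_product G y = a (power_product G x)"
      by (rule power_product_equivariant[OF AutoGroupD(1)[OF a] bij]) (rule ya)
    also have "\<dots> = \<one>"
      using x hom_one[OF AutoGroupD(1)[OF a] is_group is_group] by (simp add: zero_sum_compositions_def)
    finally show ?thesis .
  qed
  ultimately show "y \<in> zero_sum_compositions G m"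
    using x by (simp add: zero_sum_compositions_def weighted_solutions_def y_def)
  show "aut_act G a (\<lambda>g. real (x g)) = (\<lambda>g. real (y g))" by (auto simp: aut_act_def y_def)
qed

text \<open>The action is defined through the inverse of \<open>a\<close>, but invariance under
  \<open>a\<close> and under its inverse are the same condition.\<close>

lemma aut_act_fixed_iff:
  assumes a: "a \<in> carrier (AutoGroup G)" and x: "x \<in> coord_space G"
  shows "aut_act G a x = x \<longleftrightarrow> (\<forall>g\<in>carrier G. x (a g) = x g)"
proof
  note bij = AutoGroupD(2)[OF a]
  assume eq: "aut_act G a x = x"
  show "\<forall>g\<in>carrier G. x (a g) = x g"
  proof
    fix g assume g: "g \<in> carrier G"
    then have "aut_act G a x (a g) = x g"
      using bij bij_betwE[OF bij] by (simp add: aut_act_def bij_betw_inv_into_left)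
    then show "x (a g) = x g" by (simp add: eq)
  qed
next
  note bij = AutoGroupD(2)[OF a]
  assume inv: "\<forall>g\<in>carrier G. x (a g) = x g"
  show "aut_act G a x = x"
  proof
    fix g
    show "aut_act G a x g = x g"
    proof (cases "g \<in> carrier G")
      case True
      then have "inv_into (carrier G) a g \<in> carrier G"
        using bij_betwE[OF bij_betw_inv_into[OF bij]] by blast
      then have "x (a (inv_into (carrier G) a g)) = x (inv_into (carrier G) a g)" using inv by blast
      then show ?thesis using True bij by (simp add: aut_act_def bij_betw_inv_into_right)
    next
      case False
      then show ?thesis using x by (simp add: aut_act_def coord_space_def)
    qed
  qed
qed

section \<open>Integer powers, restricted actions and the sieving theorem\<close>

lemma primitive_root_powi_eq_1_iff:
  assumes "primitive_root_of_unity N z" "0 < N"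
  shows "z powi i = 1 \<longleftrightarrow> int N dvd i"
proof -
  have zN: "z ^ N = 1" using assms by (simp add: primitive_root_of_unity_def)
  then have z0: "z \<noteq> 0" using assms(2) by (auto simp: power_0_left)
  define k where "k = nat (i mod int N)"
  have k: "int k = i mod int N" "k < N" using assms(2) by (auto simp: k_def nat_less_iff)
  have "i = int N * (i div int N) + int k" unfolding k by simp
  then have "z powi i = (z powi int N) powi (i div int N) * z powi int k"
    using z0 by (metis power_int_add power_int_mult)
  then have "z powi i = z ^ k" using zN by simp
  moreover have "z ^ k = 1 \<longleftrightarrow> k = 0" using assms k(2) by (auto simp: primitive_root_of_unity_def)
  moreover have "k = 0 \<longleftrightarrow> int N dvd i" using k(1) by (metis dvd_eq_mod_eq_0 of_nat_eq_0_iff)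
  ultimately show ?thesis by simp
qed

text \<open>All of \<open>C\<close> preserves \<open>X\<close>, so the inverse in \<open>C\<close>
  also inverts the restriction, which is therefore a bijection of \<open>X\<close>.\<close>

lemma group_action_restrict:
  assumes C: "group C" and hom: "\<And>f g. f \<in> carrier C \<Longrightarrow> g \<in> carrier C \<Longrightarrow> f \<otimes>\<^bsub>C\<^esub> g = f \<circ> g"
    and one: "\<one>\<^bsub>C\<^esub> = id" and X: "\<And>f v. f \<in> carrier C \<Longrightarrow> v \<in> X \<Longrightarrow> f v \<in> X"
  shows "group_action C X (application_on X)"
proof -
  interpret C: group C by (rule C)
  have Bij: "restrict f X \<in> Bij X" if f: "f \<in> carrier C" for f
  proof -
    have "f \<circ> (inv\<^bsub>C\<^esub> f) = id" "(inv\<^bsub>C\<^esub> f) \<circ> f = id"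
      using f hom[of f "inv\<^bsub>C\<^esub> f"] hom[of "inv\<^bsub>C\<^esub> f" f] one by auto
    then have i: "f ((inv\<^bsub>C\<^esub> f) v) = v" "(inv\<^bsub>C\<^esub> f) (f v) = v" for v by (auto dest: fun_cong)
    have "bij_betw f X X"
      by (rule bij_betw_byWitness[of _ "inv\<^bsub>C\<^esub> f"]) (use f i X in auto)
    then show ?thesis by (simp add: Bij_def bij_betw_restrict_eq)
  qed
  have "application_on X \<in> hom C (BijGroup X)"
  proof (rule homI)
    fix f g assume fg: "f \<in> carrier C" "g \<in> carrier C"
    have "restrict (f \<circ> g) X = compose X (restrict f X) (restrict g X)"
      using X[OF fg(2)] by (auto simp: compose_def)
    then show "application_on X (f \<otimes>\<^bsub>C\<^esub> g) = application_on X f \<otimes>\<^bsub>BijGroup X\<^esub> application_on X g"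
      using fg Bij by (simp add: hom application_on_def BijGroup_def)
  qed (simp add: application_on_def BijGroup_def Bij)
  then show ?thesis
    by (intro group_action.intro group_hom.intro group_hom_axioms.intro C group_BijGroup)
qed

lemma eval_int_poly_at_1: "eval_int_poly 1 p = of_int (poly p 1)"
  by (induction p) (simp_all add: eval_int_poly_def map_poly_pCons)

theorem theorem1p4:
  fixes G :: "('a, 'b) monoid_scheme"
    and T :: "('a \<Rightarrow> real) \<Rightarrow> real ^ 'n"
    and c :: "'a \<Rightarrow> 'a"
    and n m d :: nat
  assumes "comm_group G" and "finite (carrier G)" and "Coset.order G = n"
    and "0 < m" and "gcd n m = 1"
    and "CARD('n) = n"
    and "linear_iso_on_coord_space G T"
    and "T ` zero_sum_lattice G = int_vectors"
    and "c \<in> carrier (AutoGroup G)" and "group.ord (AutoGroup G) c = d"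
    and "semiregular G c"
  shows "cyclic_sieving
           (dilate_lattice_points m (zero_sum_polytope G T))
           (generated_perm_group (aut_tilde G T c))
           (aut_tilde G T c)
           (application_on (dilate_lattice_points m (zero_sum_polytope G T)))
           (q_Catalan n m)"
proof -
  interpret comm_group G by fact
  interpret A: group "AutoGroup G" by (rule AutoGroup)
  note G = is_group and T = assms(7) and fin = assms(2) and c = assms(9)
  interpret h: group_hom "AutoGroup G" "BijGroup UNIV" "aut_tilde G T"
    by (rule aut_tilde_group_hom[OF G T])
  let ?\<rho> = "aut_tilde G T" and ?Z = "zero_sum_compositions G m"
  let ?C = "generated_perm_group (?\<rho> c)" and ?X = "dilate_lattice_points m (zero_sum_polytope G T)"
  let ?\<tau> = "\<lambda>x. T (\<lambda>g. real (x g))"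
  have C_def: "?C = subgroup_generated (BijGroup UNIV) {?\<rho> c}" by (simp add: generated_perm_group_def)
  have cop: "coprime (order G) m" using assms(3,5) by (simp add: coprime_iff_gcd_eq_1)
  have X: "?X = ?\<tau> ` ?Z" by (rule dilate_lattice_points_eq[OF T assms(8,4)])
  have bij_X: "bij_betw ?\<tau> ?Z ?X" unfolding X by (rule inj_on_imp_bij_betw[OF inj_on_T_real[OF G T]])
  have Z_space: "(\<lambda>g. real (x g)) \<in> coord_space G" if "x \<in> ?Z" for x
    using that real_compositions_in_coord_space[of x G m] by (simp add: zero_sum_compositions_def)
  have finZ: "finite ?Z"
    by (rule finite_subset[of _ "compositions G m"])
      (use fin finite_weighted_solutions[of "carrier G" "\<lambda>_. 1"] in \<open>auto simp: zero_sum_compositions_def\<close>)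
  have \<rho>c: "?\<rho> c \<in> carrier (BijGroup UNIV)" using c by simp
  have pow: "?\<rho> c [^]\<^bsub>?C\<^esub> j = ?\<rho> (c [^]\<^bsub>AutoGroup G\<^esub> j)" for j :: int
  proof -
    have "?\<rho> c \<in> carrier ?C"
      unfolding C_def carrier_subgroup_generated using \<rho>c by (simp add: generate.incl)
    then have "?\<rho> c [^]\<^bsub>?C\<^esub> j = ?\<rho> c [^]\<^bsub>BijGroup UNIV\<^esub> j"
      unfolding C_def by (rule h.H.int_pow_subgroup_generated)
    then show ?thesis using c by (simp add: h.hom_int_pow)
  qed
  have carrier_C: "\<exists>a\<in>carrier (AutoGroup G). f = ?\<rho> a" if "f \<in> carrier ?C" for f
  proof -
    have "f \<in> range (\<lambda>j::int. ?\<rho> c [^]\<^bsub>BijGroup UNIV\<^esub> j)"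
      using that unfolding C_def h.H.carrier_subgroup_generated_by_singleton[OF \<rho>c] .
    then show ?thesis using c by (auto simp: h.hom_int_pow[symmetric])
  qed
  have d0: "0 < d" using A.ord_ge_1[OF finite_carrier_AutoGroup[OF fin] c] assms(10) by simp
  have order_C: "order ?C = d"
    unfolding C_def using h.H.cyclic_order_is_ord[OF \<rho>c] ord_aut_tilde[OF G T c] assms(10) by simp
  have group_C: "group ?C" unfolding C_def by simp
  have fin_C: "finite (carrier ?C)"
    using d0 order_C by (simp add: order_def card_ge_0_finite)
  have c_C: "?\<rho> c \<in> carrier ?C"
    unfolding C_def carrier_subgroup_generated using \<rho>c by (simp add: generate.incl)
  \<comment> \<open>Generation is required inside \<open>?C\<close> itself, not inside the group of
    all bijections; generating again by the same element changes nothing.\<close>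
  have gen_C: "carrier ?C = generate ?C {?\<rho> c}"
  proof -
    have "carrier (subgroup_generated ?C {?\<rho> c}) = carrier ?C" unfolding C_def by simp
    then show ?thesis using c_C by (simp add: carrier_subgroup_generated)
  qed
  have \<rho>\<tau>: "?\<rho> a (?\<tau> x) = T (aut_act G a (\<lambda>g. real (x g)))" if "x \<in> ?Z" for a x
    by (rule aut_tilde_T[OF G T Z_space[OF that]])
  have action: "group_action ?C ?X (application_on ?X)"
  proof (rule group_action_restrict[OF group_C])
    fix f g assume "f \<in> carrier ?C" "g \<in> carrier ?C"
    then have "bij f" "bij g" using carrier_C bij_aut_tilde[OF G T] by blast+
    then show "f \<otimes>\<^bsub>?C\<^esub> g = f \<circ> g" unfolding C_def by (simp add: BijGroup_UNIV_mult)
  next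
    show "\<one>\<^bsub>?C\<^esub> = id" unfolding C_def by (simp add: BijGroup_UNIV)
  next
    fix f v assume "f \<in> carrier ?C" "v \<in> ?X"
    then obtain a x where a: "a \<in> carrier (AutoGroup G)" "f = ?\<rho> a" and x: "x \<in> ?Z" "v = ?\<tau> x"
      using carrier_C X by blast
    obtain y where "y \<in> ?Z" "aut_act G a (\<lambda>g. real (x g)) = (\<lambda>g. real (y g))"
      by (rule aut_act_zero_sum_compositions[OF x(1) a(1)])
    then have "f v = ?\<tau> y" using \<rho>\<tau>[OF x(1), of a] a x by simp
    then show "f v \<in> ?X" unfolding X using \<open>y \<in> ?Z\<close> by blast
  qed
  have fixed: "card {v \<in> ?X. application_on ?X (?\<rho> a) v = v} = card {x \<in> ?Z. \<forall>g\<in>carrier G. x (a g) = x g}"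
    if a: "a \<in> carrier (AutoGroup G)" for a
  proof -
    have "?\<rho> a (?\<tau> x) = ?\<tau> x \<longleftrightarrow> (\<forall>g\<in>carrier G. x (a g) = x g)" if x: "x \<in> ?Z" for x
      using T_eq_iff[OF G T aut_act_in_coord_space[of G a] Z_space[OF x]] aut_act_fixed_iff[OF a Z_space[OF x]]
      by (simp add: \<rho>\<tau>[OF x])
    then have "{v \<in> ?X. application_on ?X (?\<rho> a) v = v} = ?\<tau> ` {x \<in> ?Z. \<forall>g\<in>carrier G. x (a g) = x g}"
      unfolding application_on_def X by auto
    moreover have "inj_on ?\<tau> {x \<in> ?Z. \<forall>g\<in>carrier G. x (a g) = x g}"
      by (rule inj_on_subset[OF inj_on_T_real[OF G T]]) auto
    ultimately show ?thesis by (simp add: card_image)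
  qed
  have total: "poly (q_Catalan n m) 1 = int (card ?X)"
  proof -
    \<comment> \<open>Every composition is invariant under the identity, so the case
      \<open>e = 1\<close> with root of unity 1 gives the total count.\<close>
    have "of_nat (card {x \<in> ?Z. \<forall>g\<in>carrier G. x (id g) = x g}) = eval_int_poly 1 (q_Catalan (order G) m)"
      by (intro card_invariant_zero_sum_compositions[OF fin cop assms(4), where e = 1])
        (auto simp: primitive_root_of_unity_def hom_def bij_betw_id[unfolded id_def])
    then have "of_int (int (card ?Z)) = (of_int (poly (q_Catalan n m) 1) :: complex)"
      by (simp add: eval_int_poly_at_1 assms(3))
    then show ?thesis unfolding of_int_eq_iff using bij_betw_same_card[OF bij_X] by simp
  qed
  have sieve: "of_nat (card {v \<in> ?X. application_on ?X (?\<rho> c [^]\<^bsub>?C\<^esub> j) v = v})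
      = poly (map_poly of_int (q_Catalan n m)) (\<zeta> powi j)"
    if \<zeta>: "primitive_root_of_unity d \<zeta>" for \<zeta> and j :: int
  proof -
    \<comment> \<open>The order \<open>e\<close> of \<open>a\<close> is also that of
      \<open>\<zeta> powi j\<close>: the \<open>i\<close>-th power of either is trivial exactly when
      \<open>d\<close> divides \<open>j * i\<close>.\<close>
    define a where "a = c [^]\<^bsub>AutoGroup G\<^esub> j"
    define e where "e = A.ord a"
    have a: "a \<in> carrier (AutoGroup G)" using c by (simp add: a_def)
    have e0: "0 < e" using A.ord_ge_1[OF finite_carrier_AutoGroup[OF fin] a] by (simp add: e_def)
    have a_pow: "a [^]\<^bsub>AutoGroup G\<^esub> i = c [^]\<^bsub>AutoGroup G\<^esub> (j * int i)" for i :: nat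
      using c by (simp add: a_def A.int_pow_pow flip: int_pow_int)
    have a_pow_1: "a [^]\<^bsub>AutoGroup G\<^esub> i = \<one>\<^bsub>AutoGroup G\<^esub> \<longleftrightarrow> int d dvd j * int i" for i :: nat
      unfolding a_pow using A.int_pow_eq_id[OF c] assms(10) by simp
    have z: "primitive_root_of_unity e (\<zeta> powi j)"
    proof -
      have "(\<zeta> powi j) ^ i = 1 \<longleftrightarrow> e dvd i" for i
      proof -
        have "(\<zeta> powi j) ^ i = \<zeta> powi (j * int i)" by (simp add: power_int_mult)
        then show ?thesis
          using primitive_root_powi_eq_1_iff[OF \<zeta> d0, of "j * int i"] a_pow_1[of i] A.pow_eq_id[OF a, of i]
          by (simp add: e_def)
      qed
      then show ?thesis by (auto simp: primitive_root_of_unity_def dest: dvd_imp_le)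
    qed
    have per: "(a ^^ e) g = g" if "g \<in> carrier G" for g
    proof -
      have "a [^]\<^bsub>AutoGroup G\<^esub> e = \<one>\<^bsub>AutoGroup G\<^esub>" using a by (simp add: e_def)
      then show ?thesis using AutoGroup_pow_apply[OF a that, of e] that by (simp add: AutoGroup_one)
    qed
    have free: "(a ^^ i) g \<noteq> g" if g: "g \<in> carrier G" "g \<noteq> \<one>\<^bsub>G\<^esub>" and i: "0 < i" "i < e" for g i
    proof
      assume eq: "(a ^^ i) g = g"
      \<comment> \<open>\<open>a\<close> to the power \<open>i\<close> equals \<open>c\<close> to
        the power \<open>k\<close>. Since \<open>0 < i < e\<close>, this \<open>k\<close> is
        nonzero, so semiregularity applies to it.\<close>
      define k where "k = nat (j * int i mod int d)"
      have k: "int k = j * int i mod int d" "k < d" using d0 by (auto simp: k_def nat_less_iff)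
      have "a [^]\<^bsub>AutoGroup G\<^esub> i \<noteq> \<one>\<^bsub>AutoGroup G\<^esub>"
        using i A.pow_eq_id[OF a] by (auto simp: e_def dest: dvd_imp_le)
      then have "k \<noteq> 0" using k(1) a_pow_1 by (auto simp: dvd_eq_mod_eq_0)
      then have "{g \<in> carrier G. (c [^]\<^bsub>AutoGroup G\<^esub> k) g = g} = {\<one>\<^bsub>G\<^esub>}"
        using assms(10,11) k(2) by (simp add: semiregular_def)
      moreover have "c [^]\<^bsub>AutoGroup G\<^esub> k = a [^]\<^bsub>AutoGroup G\<^esub> i"
      proof -
        have "c [^]\<^bsub>AutoGroup G\<^esub> int k = c [^]\<^bsub>AutoGroup G\<^esub> (j * int i)"
          unfolding A.int_pow_eq[OF c] k(1) assms(10) by (simp add: mod_eq_dvd_iff[symmetric])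
        then show ?thesis by (simp add: a_pow int_pow_int)
      qed
      ultimately show False using g eq AutoGroup_pow_apply[OF a g(1), of i] by auto
    qed
    have "of_nat (card {x \<in> ?Z. \<forall>g\<in>carrier G. x (a g) = x g})
        = eval_int_poly (\<zeta> powi j) (q_Catalan (order G) m)"
      by (rule card_invariant_zero_sum_compositions)
        (fact fin cop assms(4) AutoGroupD(1,2)[OF a] e0 per free z)+
    then show ?thesis using fixed[OF a] by (simp add: pow a_def eval_int_poly_def assms(3))
  qed
  have nonneg: "0 \<le> Polynomial.coeff (q_Catalan n m) i" for i
    using coeff_q_Catalan_nonneg[OF _ assms(4)] cop assms(3) by simp
  show ?thesis
    unfolding cyclic_sieving_def order_C
    using finZ group_C fin_C c_C gen_C action nonneg total sieve by (simp add: X)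
qed

end
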